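(* The assignment that sends a fanning curve $\ell(t)$ in $Gr(n,\mathbb{R}^{kn})$ to its horizontal curve $h(t)$ is characterized by the following four properties (that is, it satisfies them, and it is the only assignment of a curve $h(t)$ of $n$-dimensional subspaces of $\mathbb{R}^{kn}$ to each fanning curve $\ell(t)$ which satisfies them): 1. At each $t$, the subspace $h(t)$ is transversal to $\mathrm{Span}\{A(t),\dots,A^{(k-2)}(t)\}$, where $A(t)$ is a frame spanning $\ell(t)$. 2. The subspace $h(\tau)$ depends only on the $k$-jet of the curve $\ell(t)$ at $t=\tau$. 3. If $T\in GL(kn)$, the curve assigned to $T\ell(t)$ is $Th(t)$. 4. If $\ell(t)$ is spanned by a curve of the form $A_0+tA_1+\cdots+t^{k-1}A_{k-1}$ in the space of frames, then $h(t)$ is constant.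
   Context: Let $n\ge1$, $k\ge2$ be integers; all curves are smooth. A frame is a curve $A(t)$ of real $kn\times n$ matrices; it is fanning if $(A(t)|\dot A(t)|\cdots|A^{(k-1)}(t))$ is an invertible $kn\times kn$ matrix for all $t$. A curve $\ell(t)\in Gr(n,\mathbb{R}^{kn})$ is fanning if it is spanned by (is the column space of) a fanning frame; the space $v(t)=\mathrm{Span}\{A(t),\dots,A^{(k-2)}(t)\}$ (span of all columns) depends only on $\ell$. In property 4, $A_0,\dots,A_{k-1}$ are constant $kn\times n$ matrices. The fundamental endomorphism $F(t)$ of $\ell$ is the linear map of $\mathbb{R}^{kn}$ with $FA=0$ and $FA^{(i)}=iA^{(i-1)}$ for $1\le i\le k-1$; it does not depend on the frame $A$ spanning $\ell$. Put $D=\frac1k(2\dot F-(k-2)I)$ and $P=\frac12(I-D)$; $P(t)$ is a projection with image $v(t)$. The horizontal curve of $\ell$ is $h(t)=\ker P(t)$, an $n$-dimensional subspace. Jets: $J^k_f(\mathbb{R};Gr(n,\mathbb{R}^{kn}))$ is the set of tuples $(A,\dot A,\dots,A^{(k)})$ of $kn\times n$ matrices with $(A|\cdots|A^{(k-1)})$ invertible, modulo the right action of jets $(X,\dot X,\dots,X^{(k)})$, $X\in GL(n)$, by the Leibniz rule (the $m$-th entry becomes $\sum_{i=0}^m\binom{m}{i}A^{(m-i)}X^{(i)}$). The $k$-jet of $\ell$ at $\tau$ is the class of $(A(\tau),\dots,A^{(k)}(\tau))$; the value $\tau$ itself is not part of the jet. Property 2 means that there is a single map $j:J^k_f(\mathbb{R};Gr(n,\mathbb{R}^{kn}))\to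 Gr(n,\mathbb{R}^{kn})$ such that $h(\tau)$ is the image under $j$ of the $k$-jet of $\ell$ at $\tau$, for all fanning curves $\ell$ and all $\tau$. Transversal means complementary: $\mathbb{R}^{kn}=v(t)\oplus h(t)$. *)

theory Defs
  imports "HOL-Analysis.Analysis"
begin

text \<open>
  The numbers \<open>k\<close> and \<open>n\<close> are the cardinalities of finite index types \<open>'k\<close> and \<open>'n\<close>,
  and \<open>\<real>\<^sup>k\<^sup>n\<close> has coordinates indexed by \<open>'k \<times> 'n\<close>.  Elements of \<open>real^'n^('k \<times> 'n)\<close> are
  matrices with \<open>kn\<close> rows and \<open>n\<close> columns.  Curves are parametrised by all of \<open>\<real>\<close>.
\<close>

primrec vderiv :: "nat \<Rightarrow> (real \<Rightarrow> 'a::real_normed_vector) \<Rightarrow> real \<Rightarrow> 'a" where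
  "vderiv 0 f = f"
| "vderiv (Suc i) f = (\<lambda>t. vector_derivative (vderiv i f) (at t))"

definition smooth_curve :: "(real \<Rightarrow> 'a::real_normed_vector) \<Rightarrow> bool" where
  "smooth_curve f \<longleftrightarrow> (\<forall>i t. vderiv i f differentiable (at t))"

definition colspan :: "real^'n^'m \<Rightarrow> (real^'m) set" where
  "colspan A = span (columns A)"

definition grassmannian :: "(real^('k::finite \<times> 'n::finite)) set set" where
  "grassmannian = {V. subspace V \<and> dim V = CARD('n)}"

text \<open>
  The square matrix \<open>(A\<^sub>0 | A\<^sub>1 | \<dots> | A\<^sub>k\<^sub>-\<^sub>1)\<close>.  On a finite type, \<open>to_nat_on UNIV\<close> is a
  bijection onto \<open>{..<CARD('k)}\<close>; the order in which it lists the blocks is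
  irrelevant for invertibility, the only thing the block matrix is used for.
\<close>

definition block_matrix ::
    "(nat \<Rightarrow> real^'n^('k \<times> 'n)) \<Rightarrow> real^('k::finite \<times> 'n::finite)^('k \<times> 'n)" where
  "block_matrix As = (\<chi> r c. As (to_nat_on (UNIV :: 'k set) (fst c)) $ r $ snd c)"

definition fanning_frame :: "(real \<Rightarrow> real^'n^('k::finite \<times> 'n::finite)) \<Rightarrow> bool" where
  "fanning_frame A \<longleftrightarrow>
     smooth_curve A \<and> (\<forall>t. invertible (block_matrix (\<lambda>i. vderiv i A t)))"

definition spans_curve ::
    "(real \<Rightarrow> real^'n^('k::finite \<times> 'n::finite)) \<Rightarrow> (real \<Rightarrow> (real^('k \<times> 'n)) set) \<Rightarrow> bool" where
  "spans_curve A l \<longleftrightarrow> (\<forall>t. l t = colspan (A t))"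

definition fanning_curve :: "(real \<Rightarrow> (real^('k::finite \<times> 'n::finite)) set) \<Rightarrow> bool" where
  "fanning_curve l \<longleftrightarrow>
     (\<exists>A :: real \<Rightarrow> real^'n^('k \<times> 'n). fanning_frame A \<and> spans_curve A l)"

text \<open>
  A smooth curve in the Grassmannian defined on all of \<open>\<real>\<close> lifts to a smooth
  curve of matrices of rank \<open>n\<close>.
\<close>

definition smooth_grassmannian_curve ::
    "(real \<Rightarrow> (real^('k::finite \<times> 'n::finite)) set) \<Rightarrow> bool" where
  "smooth_grassmannian_curve h \<longleftrightarrow>
     (\<forall>t. h t \<in> grassmannian) \<and>
     (\<exists>B :: real \<Rightarrow> real^'n^('k \<times> 'n). smooth_curve B \<and> spans_curve B h)"

definition vertical_space ::
    "(real \<Rightarrow> real^'n^('k::finite \<times> 'n::finite)) \<Rightarrow> real \<Rightarrow> (real^('k \<times> 'n)) set" where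
  "vertical_space A t = span (\<Union>i\<in>{0..CARD('k) - 2}. columns (vderiv i A t))"

definition complementary :: "'a::real_vector set \<Rightarrow> 'a set \<Rightarrow> bool" where
  "complementary V W \<longleftrightarrow> V \<inter> W = {0} \<and> {v + w | v w. v \<in> V \<and> w \<in> W} = UNIV"

definition is_fundamental_endomorphism ::
    "(real \<Rightarrow> real^'n^('k::finite \<times> 'n::finite)) \<Rightarrow> real \<Rightarrow> real^('k \<times> 'n)^('k \<times> 'n) \<Rightarrow> bool" where
  "is_fundamental_endomorphism A t F \<longleftrightarrow>
     F ** A t = 0 \<and>
     (\<forall>i\<in>{1..CARD('k) - 1}. F ** vderiv i A t = real i *\<^sub>R vderiv (i - 1) A t)"

definition fundamental_endomorphism ::
    "(real \<Rightarrow> (real^('k::finite \<times> 'n::finite)) set) \<Rightarrow> real \<Rightarrow> real^('k \<times> 'n)^('k \<times> 'n)" where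
  "fundamental_endomorphism l t =
     (THE F. \<forall>A. fanning_frame A \<and> spans_curve A l \<longrightarrow> is_fundamental_endomorphism A t F)"

definition D_endomorphism ::
    "(real \<Rightarrow> (real^('k::finite \<times> 'n::finite)) set) \<Rightarrow> real \<Rightarrow> real^('k \<times> 'n)^('k \<times> 'n)" where
  "D_endomorphism l t =
     (1 / real CARD('k)) *\<^sub>R
       (2 *\<^sub>R vector_derivative (fundamental_endomorphism l) (at t)
        - (real CARD('k) - 2) *\<^sub>R mat 1)"

definition vertical_projection ::
    "(real \<Rightarrow> (real^('k::finite \<times> 'n::finite)) set) \<Rightarrow> real \<Rightarrow> real^('k \<times> 'n)^('k \<times> 'n)" where
  "vertical_projection l t = (1/2) *\<^sub>R (mat 1 - D_endomorphism l t)"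

definition horizontal_curve ::
    "(real \<Rightarrow> (real^('k::finite \<times> 'n::finite)) set) \<Rightarrow> real \<Rightarrow> (real^('k \<times> 'n)) set" where
  "horizontal_curve l t = {x. vertical_projection l t *v x = 0}"

text \<open>
  A tuple \<open>(A\<^sub>0, \<dots>, A\<^sub>k)\<close> is represented by a function on \<open>nat\<close> of which only the
  values at \<open>0, \<dots>, k\<close> matter: \<open>jet_rel\<close> identifies functions that agree there.
\<close>

definition fanning_tuples :: "(nat \<Rightarrow> real^'n^('k::finite \<times> 'n::finite)) set" where
  "fanning_tuples = {As. invertible (block_matrix As)}"

definition jet_rel ::
    "((nat \<Rightarrow> real^'n^('k::finite \<times> 'n::finite)) \<times> (nat \<Rightarrow> real^'n^('k \<times> 'n))) set" where
  "jet_rel = {(As, Bs). As \<in> fanning_tuples \<and> Bs \<in> fanning_tuples \<and>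
     (\<exists>X :: nat \<Rightarrow> real^'n^'n. invertible (X 0) \<and>
        (\<forall>m\<le>CARD('k). Bs m = (\<Sum>i=0..m. real (m choose i) *\<^sub>R (As (m - i) ** X i))))}"

definition jet_space :: "(nat \<Rightarrow> real^'n^('k::finite \<times> 'n::finite)) set set" where
  "jet_space = fanning_tuples // jet_rel"

definition jet_class ::
    "(real \<Rightarrow> real^'n^('k::finite \<times> 'n::finite)) \<Rightarrow> real \<Rightarrow> (nat \<Rightarrow> real^'n^('k \<times> 'n)) set" where
  "jet_class A t = jet_rel `` {\<lambda>i. vderiv i A t}"

text \<open>
  An assignment is a total function in HOL; only its values on fanning curves are
  constrained and compared.
\<close>

type_synonym ('k, 'n) assignment =
  "(real \<Rightarrow> (real, 'k \<times> 'n) vec set) \<Rightarrow> real \<Rightarrow> (real, 'k \<times> 'n) vec set"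

definition grassmannian_assignment :: "('k::finite, 'n::finite) assignment \<Rightarrow> bool" where
  "grassmannian_assignment H \<longleftrightarrow>
     (\<forall>l. fanning_curve l \<longrightarrow> smooth_grassmannian_curve (H l))"

definition transversality :: "('k::finite, 'n::finite) assignment \<Rightarrow> bool" where
  "transversality H \<longleftrightarrow>
     (\<forall>l A t. fanning_frame A \<and> spans_curve A l \<longrightarrow> complementary (vertical_space A t) (H l t))"

definition k_jet_dependence :: "('k::finite, 'n::finite) assignment \<Rightarrow> bool" where
  "k_jet_dependence H \<longleftrightarrow>
     (\<exists>j :: (nat \<Rightarrow> real^'n^('k \<times> 'n)) set \<Rightarrow> (real^('k \<times> 'n)) set.
        j \<in> jet_space \<rightarrow> grassmannian \<and>
        (\<forall>l A \<tau>. fanning_frame A \<and> spans_curve A l \<longrightarrow> H l \<tau> = j (jet_class A \<tau>)))"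

definition GL_equivariance :: "('k::finite, 'n::finite) assignment \<Rightarrow> bool" where
  "GL_equivariance H \<longleftrightarrow>
     (\<forall>l (T :: real^('k \<times> 'n)^('k \<times> 'n)). fanning_curve l \<and> invertible T \<longrightarrow>
        H (\<lambda>t. (*v) T ` l t) = (\<lambda>t. (*v) T ` H l t))"

definition constant_on_polynomials :: "('k::finite, 'n::finite) assignment \<Rightarrow> bool" where
  "constant_on_polynomials H \<longleftrightarrow>
     (\<forall>l (As :: nat \<Rightarrow> real^'n^('k \<times> 'n)).
        fanning_curve l \<and> spans_curve (\<lambda>t. \<Sum>i=0..CARD('k) - 1. t ^ i *\<^sub>R As i) l \<longrightarrow>
        (\<exists>V. \<forall>t. H l t = V))"

definition four_properties :: "('k::finite, 'n::finite) assignment \<Rightarrow> bool" where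
  "four_properties H \<longleftrightarrow>
     transversality H \<and> k_jet_dependence H \<and> GL_equivariance H \<and> constant_on_polynomials H"

end

theory Submission
  imports Defs
begin

text \<open>
  Let $A$ be a frame of a fanning curve and $F$ its fundamental endomorphism. Differentiating
  $F A^{(i)} = i A^{(i-1)}$ shows that $P$ fixes $A, \dots, A^{(k-2)}$ and that
  $P A^{(k-1)} = \frac1k F A^{(k)}$, so the horizontal curve is spanned by the single block
  \[ A^{(k-1)} - \frac1k F A^{(k)} \]
  (lemma \<open>horizontal_curve_eq\<close>). All four properties can be read off from this formula.
  It is $A^{(k-1)}$ modulo the vertical space; it involves $k$ derivatives and changes by an
  invertible factor on the right when the frame does (\<open>horizontal_block_jet_mult\<close>); it is
  equivariant because $F$ is; and for a polynomial of degree below $k$ the second term vanishes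
  while the first is constant. That $F$ and the change of frame are smooth comes from
  smoothness of the inverse of $(A|\cdots|A^{(k-1)})$ (\<open>smooth_matrix_inv\<close>).

  For uniqueness, every $k$-jet is the jet at the origin of a polynomial frame
  $B(t) = \sum_{i<k} \frac{t^i}{i!} B_i$, because a change of frame can kill the $k$-th
  derivative (\<open>jet_of_polynomial\<close>). As only the $k$-jet matters, it suffices to determine
  the constant value $V$ of an assignment on the curve of $B$. By equivariance $V$ is invariant
  under the linear maps $B_i \mapsto B_i g$ with $g \in GL(n)$, which preserve the curve, and
  under the shift $B^{(i)}(0) \mapsto B^{(i)}(1)$, which carries the jet at $0$ to the jet at $1$.
  For a complement of the vertical space, the first kind of invariance forces every vector
  to have the form $\sum_i \lambda_i B_i e$, and invariance under the unipotent shift then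
  leaves only the span of $B_{k-1}$ (\<open>invariant_complement_subset_last_block\<close>). So any two
  assignments with the four properties agree.
\<close>

section \<open>Smooth curves of matrices\<close>

lemma bounded_bilinear_matrix_mult:
  "bounded_bilinear ((**) :: real^'b^'a \<Rightarrow> real^'c^'b \<Rightarrow> real^'c^'a)"
proof -
  have "linear (\<lambda>B::real^'c^'b. (A::real^'b^'a) ** B)" for A
    by (auto intro!: linearI simp: matrix_matrix_mult_def vec_eq_iff
        sum_distrib_left distrib_left sum.distrib mult_ac)
  moreover have "linear (\<lambda>A::real^'b^'a. A ** (B::real^'c^'b))" for B
    by (auto intro!: linearI simp: matrix_matrix_mult_def vec_eq_iff
        sum_distrib_left distrib_right distrib_left sum.distrib mult_ac)
  ultimately show ?thesis
    by (simp add: bilinear_conv_bounded_bilinear[symmetric] bilinear_def)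
qed

interpretation mat_mult: bounded_bilinear "(**) :: real^'b^'a \<Rightarrow> real^'c^'b \<Rightarrow> real^'c^'a"
  by (rule bounded_bilinear_matrix_mult)

lemma bounded_bilinear_matrix_vector_mult:
  "bounded_bilinear ((*v) :: real^'b^'a \<Rightarrow> real^'b \<Rightarrow> real^'a)"
proof -
  have "linear (\<lambda>A::real^'b^'a. A *v x)" for x
    by (auto intro!: linearI simp: matrix_vector_mult_add_rdistrib scaleR_matrix_vector_assoc)
  then show ?thesis
    by (simp add: bilinear_conv_bounded_bilinear[symmetric] bilinear_def)
qed

interpretation mat_vec: bounded_bilinear "(*v) :: real^'b^'a \<Rightarrow> real^'b \<Rightarrow> real^'a"
  by (rule bounded_bilinear_matrix_vector_mult)

lemma smooth_curve_has_vector_derivative: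
  assumes "smooth_curve f"
  shows "(vderiv i f has_vector_derivative vderiv (Suc i) f t) (at t)"
  using assms by (simp add: smooth_curve_def vector_derivative_works)

text \<open>
  Derivatives of explicit curves are computed by guessing the whole sequence of them:
  a sequence in which each curve differentiates to the next one must be the sequence
  of iterated derivatives of its first member.
\<close>

lemma vderiv_tower:
  assumes "\<And>i t. (g i has_vector_derivative g (Suc i) t) (at t)"
  shows "vderiv i (g 0) = g i"
proof (induction i)
  case (Suc i)
  then show ?case
    using vector_derivative_at[OF assms[of i]] by auto
qed simp

lemma smooth_tower:
  assumes "\<And>i t. (g i has_vector_derivative g (Suc i) t) (at t)"
  shows "smooth_curve (g 0)"
  unfolding smooth_curve_def vderiv_tower[of g, OF assms]
  using assms by (blast intro: differentiableI_vector)

text \<open>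
  A coinduction principle. Smoothness of a curve with no closed formula for its higher
  derivatives follows from exhibiting a family of curves which contains it and is stable
  under differentiation; this is how the inverse matrix is treated below.
\<close>

lemma smooth_if_closed_under_derivative:
  assumes cl: "\<And>f. f \<in> S \<Longrightarrow> \<exists>f'\<in>S. \<forall>t. (f has_vector_derivative f' t) (at t)"
    and "f \<in> S"
  shows "smooth_curve f"
proof -
  from cl obtain d where d: "\<And>f. f \<in> S \<Longrightarrow> d f \<in> S"
    "\<And>f t. f \<in> S \<Longrightarrow> (f has_vector_derivative d f t) (at t)"
    by metis
  define g where "g i = (d ^^ i) f" for i
  have "g i \<in> S" for i
    by (induction i) (auto simp: g_def d(1) \<open>f \<in> S\<close>)
  then have "smooth_curve (g 0)"
    by (intro smooth_tower) (auto simp: g_def intro!: d(2))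
  then show ?thesis by (simp add: g_def)
qed

lemma smooth_vderiv: "smooth_curve f \<Longrightarrow> smooth_curve (vderiv i f)"
proof -
  assume f: "smooth_curve f"
  have "smooth_curve (vderiv (i + 0) f)"
    by (rule smooth_tower[where g = "\<lambda>m. vderiv (i + m) f"])
       (use smooth_curve_has_vector_derivative[OF f] in simp)
  then show ?thesis by simp
qed

lemma
  assumes L: "bounded_linear L" and f: "smooth_curve f"
  shows smooth_linear: "smooth_curve (\<lambda>t. L (f t))"
    and vderiv_linear: "vderiv i (\<lambda>t. L (f t)) = (\<lambda>t. L (vderiv i f t))"
proof -
  define g where "g i = (\<lambda>t. L (vderiv i f t))" for i
  have "(g i has_vector_derivative g (Suc i) t) (at t)" for i t
    unfolding g_def
    by (intro bounded_linear.has_vector_derivative[OF L] smooth_curve_has_vector_derivative f)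
  note smooth_tower[of g, OF this] vderiv_tower[of g, OF this]
  then show "smooth_curve (\<lambda>t. L (f t))" "vderiv i (\<lambda>t. L (f t)) = (\<lambda>t. L (vderiv i f t))"
    by (simp_all add: g_def)
qed

lemma smooth_sum:
  assumes "\<And>j. j \<in> J \<Longrightarrow> smooth_curve (f j)"
  shows "smooth_curve (\<lambda>t. \<Sum>j\<in>J. f j t)"
  using assms
  by (intro smooth_tower[where g = "\<lambda>i t. \<Sum>j\<in>J. vderiv i (f j) t", simplified]
      has_vector_derivative_sum smooth_curve_has_vector_derivative[unfolded vderiv.simps])

lemma smooth_diff:
  assumes "smooth_curve f" "smooth_curve g"
  shows "smooth_curve (\<lambda>t. f t - g t)"
  using assms
  by (intro smooth_tower[where g = "\<lambda>i t. vderiv i f t - vderiv i g t", simplified]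
      has_vector_derivative_diff smooth_curve_has_vector_derivative[unfolded vderiv.simps])

section \<open>The Leibniz product\<close>

text \<open>
  The Leibniz formula, read as a product of two jets. It is at once the sequence of
  derivatives of a product of curves and the action of jets in $GL(n)$ on jets of frames.
\<close>

definition jet_mult :: "(nat \<Rightarrow> real^'b^'a) \<Rightarrow> (nat \<Rightarrow> real^'c^'b) \<Rightarrow> nat \<Rightarrow> real^'c^'a" where
  "jet_mult As X m = (\<Sum>i=0..m. real (m choose i) *\<^sub>R (As (m - i) ** X i))"

text \<open>
  Pascal's rule for binomial coefficients, in the form of the product rule.
\<close>

lemma jet_mult_Suc:
  "jet_mult As X (Suc m) = jet_mult (\<lambda>i. As (Suc i)) X m + jet_mult As (\<lambda>i. X (Suc i)) m"
proof -
  have "jet_mult As X (Suc m)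
     = As (Suc m) ** X 0 + (\<Sum>i=0..m. real (Suc m choose Suc i) *\<^sub>R (As (m - i) ** X (Suc i)))"
    unfolding jet_mult_def by (subst sum.atLeast0_atMost_Suc_shift) simp
  also have "(\<Sum>i=0..m. real (Suc m choose Suc i) *\<^sub>R (As (m - i) ** X (Suc i)))
     = jet_mult As (\<lambda>i. X (Suc i)) m
       + (\<Sum>i=0..m. real (m choose Suc i) *\<^sub>R (As (m - i) ** X (Suc i)))"
    by (simp add: jet_mult_def scaleR_left_distrib sum.distrib)
  also have "As (Suc m) ** X 0 + (jet_mult As (\<lambda>i. X (Suc i)) m
       + (\<Sum>i=0..m. real (m choose Suc i) *\<^sub>R (As (m - i) ** X (Suc i))))
     = jet_mult As (\<lambda>i. X (Suc i)) m +
        (\<Sum>i=0..Suc m. real (m choose i) *\<^sub>R (As (Suc m - i) ** X i))"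
    by (subst sum.atLeast0_atMost_Suc_shift) simp
  also have "(\<Sum>i=0..Suc m. real (m choose i) *\<^sub>R (As (Suc m - i) ** X i))
      = jet_mult (\<lambda>i. As (Suc i)) X m"
    by (simp add: jet_mult_def Suc_diff_le)
  finally show ?thesis by (simp add: add.commute)
qed

lemma
  assumes f: "smooth_curve A" and x: "smooth_curve X"
  shows smooth_matrix_mult: "smooth_curve (\<lambda>t. A t ** X t)"
    and vderiv_matrix_mult:
      "vderiv m (\<lambda>t. A t ** X t) t = jet_mult (\<lambda>i. vderiv i A t) (\<lambda>i. vderiv i X t) m"
proof -
  define g where "g m t = jet_mult (\<lambda>i. vderiv i A t) (\<lambda>i. vderiv i X t) m" for m t
  have g: "(g m has_vector_derivative g (Suc m) t) (at t)" for m t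
    unfolding g_def jet_mult_Suc
    unfolding jet_mult_def sum.distrib[symmetric] scaleR_add_right[symmetric]
    by (intro has_vector_derivative_sum
        bounded_linear.has_vector_derivative[OF bounded_linear_scaleR_right])
       (subst add.commute, intro mat_mult.has_vector_derivative
         smooth_curve_has_vector_derivative f x)
  have g0: "g 0 = (\<lambda>t. A t ** X t)"
    by (rule ext) (simp add: g_def jet_mult_def)
  show "smooth_curve (\<lambda>t. A t ** X t)"
    using smooth_tower[of g, OF g] g0 by simp
  show "vderiv m (\<lambda>t. A t ** X t) t = jet_mult (\<lambda>i. vderiv i A t) (\<lambda>i. vderiv i X t) m"
    using vderiv_tower[of g, OF g] g0 g_def by simp
qed

section \<open>The inverse of a smooth curve of matrices\<close>

text \<open>
  Differentiability can be tested on the entries because a matrix is the sum of its entries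
  times the matrix units.
\<close>

lemma differentiable_matrixI:
  fixes f :: "real \<Rightarrow> real^'b^'a"
  assumes "\<And>i j. (\<lambda>t. f t $ i $ j) differentiable (at t)"
  shows "f differentiable (at t)"
proof -
  have sum_if: "(\<Sum>b\<in>UNIV. if P then h b else 0) = (if P then sum h UNIV else 0)"
    for P and h :: "'b \<Rightarrow> real"
    by simp
  have "f = (\<lambda>t. \<Sum>i\<in>UNIV. \<Sum>j\<in>UNIV. f t $ i $ j *\<^sub>R axis i (axis j 1))"
    by (auto simp: fun_eq_iff vec_eq_iff axis_def if_distrib[of "\<lambda>x. x $ _"]
        if_distrib[of "\<lambda>x. _ * x"] sum_if cong: if_cong)
  moreover have "(\<lambda>t. \<Sum>i\<in>UNIV. \<Sum>j\<in>UNIV. f t $ i $ j *\<^sub>R axis i (axis j 1) :: real^'b^'a)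
     differentiable (at t)"
    by (intro differentiable_sum ballI finite differentiable_scaleR assms differentiable_const)
  ultimately show ?thesis by simp
qed

lemma differentiable_det:
  fixes f :: "real \<Rightarrow> real^'a^'a"
  assumes "\<And>i j. (\<lambda>t. f t $ i $ j) differentiable (at t)"
  shows "(\<lambda>t. det (f t)) differentiable (at t)"
proof -
  obtain d where d: "\<And>i j. ((\<lambda>t. f t $ i $ j) has_derivative d i j) (at t)"
    using assms unfolding differentiable_def by metis
  show ?thesis
    unfolding det_def differentiable_def
    by (rule exI, (rule derivative_intros has_derivative_prod d)+)
qed

lemma
  fixes M :: "real^'a^'b"
  assumes "invertible M"
  shows matrix_inv_right: "M ** matrix_inv M = mat 1"
    and matrix_inv_left: "matrix_inv M ** M = mat 1"
  using someI_ex[OF assms[unfolded invertible_def]] by (simp_all add: matrix_inv_def)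

text \<open>
  Cramer's rule exhibits the entries of the inverse as quotients of determinants, which makes
  differentiability of the inverse evident.
\<close>

lemma matrix_inv_Cramer:
  assumes "invertible (M :: real^'a^'a)"
  shows "matrix_inv M $ i $ j
    = det (\<chi> r c. if c = i then axis j 1 $ r else M $ r $ c) / det M"
proof -
  have "M *v (matrix_inv M *v axis j 1) = axis j 1"
    using assms by (simp add: matrix_vector_mul_assoc matrix_inv_right)
  then have "matrix_inv M *v axis j 1 = (\<chi> i. det (\<chi> r c. if c = i then axis j 1 $ r else M $ r $ c) / det M)"
    using assms cramer[of M "matrix_inv M *v axis j 1" "axis j 1"] by (simp add: invertible_det_nz)
  moreover have "(matrix_inv M *v axis j 1) $ i = matrix_inv M $ i $ j"
    by (simp add: matrix_vector_mult_basis column_def)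
  ultimately show ?thesis by simp
qed

lemma differentiable_matrix_inv:
  fixes M :: "real \<Rightarrow> real^'a^'a"
  assumes inv: "\<And>t. invertible (M t)" and M: "\<And>t. M differentiable (at t)"
  shows "(\<lambda>t. matrix_inv (M t)) differentiable (at t)"
proof -
  have e: "(\<lambda>t. M t $ i $ j) differentiable (at t)" for i j t
    using differentiable_compose[OF bounded_linear_imp_differentiable M,
        OF bounded_linear_compose[OF bounded_linear_vec_nth[of j] bounded_linear_vec_nth[of i]]] .
  show ?thesis
  proof (rule differentiable_matrixI)
    fix i j
    have e': "(\<lambda>t. (\<chi> r c. if c = i then axis j 1 $ r else M t $ r $ c) $ a $ b) differentiable (at t)" for a b
      by (cases "b = i") (simp_all add: e)
    have "det (M t) \<noteq> 0"
      using inv by (simp add: invertible_det_nz)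
    then show "(\<lambda>t. matrix_inv (M t) $ i $ j) differentiable (at t)"
      unfolding matrix_inv_Cramer[OF inv]
      by (intro differentiable_divide differentiable_det e e')
  qed
qed

text \<open>
  Once the inverse is known to be differentiable, differentiating
  $M M^{-1} = I$ gives $(M^{-1})' = - M^{-1} M' M^{-1}$.
\<close>

lemma has_vector_derivative_matrix_inv:
  fixes M :: "real \<Rightarrow> real^'a^'a"
  assumes inv: "\<And>t. invertible (M t)" and M: "\<And>t. (M has_vector_derivative M' t) (at t)"
  shows "((\<lambda>t. matrix_inv (M t)) has_vector_derivative
           0 - matrix_inv (M t) ** (M' t ** matrix_inv (M t))) (at t)"
proof -
  obtain Y' where Y: "((\<lambda>t. matrix_inv (M t)) has_vector_derivative Y') (at t)"
    using differentiable_matrix_inv[OF inv differentiableI_vector[OF M]]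
    by (auto simp: vector_derivative_works)
  have "((\<lambda>t. M t ** matrix_inv (M t)) has_vector_derivative
          M t ** Y' + M' t ** matrix_inv (M t)) (at t)"
    by (rule mat_mult.has_vector_derivative[OF M Y])
  then have "((\<lambda>t. mat 1 :: real^'a^'a) has_vector_derivative M t ** Y' + M' t ** matrix_inv (M t)) (at t)"
    by (simp add: matrix_inv_right inv)
  then have "M t ** Y' + M' t ** matrix_inv (M t) = 0"
    using vector_derivative_unique_at[OF _ has_vector_derivative_const] by blast
  then have "matrix_inv (M t) ** (M t ** Y') + matrix_inv (M t) ** (M' t ** matrix_inv (M t)) = 0"
    by (metis matrix_add_ldistrib mat_mult.zero_right)
  then have "Y' = 0 - matrix_inv (M t) ** (M' t ** matrix_inv (M t))"
    by (simp add: matrix_mul_assoc matrix_inv_left inv eq_neg_iff_add_eq_0)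
  with Y show ?thesis by simp
qed

text \<open>
  The algebra generated by $M^{-1}$ and the derivatives of $M$. It is stable under
  differentiation because $(M^{-1})' = - M^{-1} M' M^{-1}$ lies in it again, so all its
  members are smooth.
\<close>

inductive_set derivative_closure :: "(real \<Rightarrow> real^'a^'a) \<Rightarrow> (real \<Rightarrow> real^'a^'a) set"
  for M where
  inverse: "(\<lambda>t. matrix_inv (M t)) \<in> derivative_closure M"
| deriv: "vderiv i M \<in> derivative_closure M"
| zero: "(\<lambda>t. 0) \<in> derivative_closure M"
| mult: "f \<in> derivative_closure M \<Longrightarrow> g \<in> derivative_closure M \<Longrightarrow>
    (\<lambda>t. f t ** g t) \<in> derivative_closure M"
| add: "f \<in> derivative_closure M \<Longrightarrow> g \<in> derivative_closure M \<Longrightarrow>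
    (\<lambda>t. f t + g t) \<in> derivative_closure M"
| diff: "f \<in> derivative_closure M \<Longrightarrow> g \<in> derivative_closure M \<Longrightarrow>
    (\<lambda>t. f t - g t) \<in> derivative_closure M"

lemma smooth_matrix_inv:
  fixes M :: "real \<Rightarrow> real^'a^'a"
  assumes M: "smooth_curve M" and inv: "\<And>t. invertible (M t)"
  shows "smooth_curve (\<lambda>t. matrix_inv (M t))"
proof (rule smooth_if_closed_under_derivative)
  note intros = derivative_closure.intros
  show "(\<lambda>t. matrix_inv (M t)) \<in> derivative_closure M" by (rule intros)
  fix f assume "f \<in> derivative_closure M"
  then show "\<exists>f'\<in>derivative_closure M. \<forall>t. (f has_vector_derivative f' t) (at t)"
  proof induction
    case inverse
    have "(\<lambda>t. 0 - matrix_inv (M t) ** (vderiv (Suc 0) M t ** matrix_inv (M t))) \<in> derivative_closure M"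
      by (intro intros)
    moreover have "(M has_vector_derivative vderiv (Suc 0) M t) (at t)" for t
      using smooth_curve_has_vector_derivative[OF M, of 0] by simp
    then have "((\<lambda>t. matrix_inv (M t)) has_vector_derivative
        0 - matrix_inv (M t) ** (vderiv (Suc 0) M t ** matrix_inv (M t))) (at t)" for t
      by (rule has_vector_derivative_matrix_inv[OF inv])
    ultimately show ?case by (intro bexI allI)
  next
    case (deriv i)
    then show ?case
      using smooth_curve_has_vector_derivative[OF M, of i] intros(2)[where i = "Suc i"] by blast
  next
    case zero
    show ?case
      by (intro bexI[of _ "\<lambda>t. 0"] allI has_vector_derivative_const intros(3))
  next
    case (mult f g)
    then obtain f' g' where *: "f' \<in> derivative_closure M" "g' \<in> derivative_closure M"
      "\<And>t. (f has_vector_derivative f' t) (at t)" "\<And>t. (g has_vector_derivative g' t) (at t)" by blast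
    then have "(\<lambda>t. f t ** g' t + f' t ** g t) \<in> derivative_closure M"
      using mult by (intro intros) auto
    then show ?case
      by (intro bexI[of _ "\<lambda>t. f t ** g' t + f' t ** g t"] allI mat_mult.has_vector_derivative *(3,4))
  next
    case (add f g)
    then obtain f' g' where *: "f' \<in> derivative_closure M" "g' \<in> derivative_closure M"
      "\<And>t. (f has_vector_derivative f' t) (at t)" "\<And>t. (g has_vector_derivative g' t) (at t)" by blast
    then show ?case
      by (intro bexI[of _ "\<lambda>t. f' t + g' t"] allI has_vector_derivative_add intros(5))
  next
    case (diff f g)
    then obtain f' g' where *: "f' \<in> derivative_closure M" "g' \<in> derivative_closure M"
      "\<And>t. (f has_vector_derivative f' t) (at t)" "\<And>t. (g has_vector_derivative g' t) (at t)" by blast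
    then show ?case
      by (intro bexI[of _ "\<lambda>t. f' t - g' t"] allI has_vector_derivative_diff intros(6))
  qed
qed

section \<open>Block matrices\<close>

lemma colspan_eq_range: "colspan A = range ((*v) A)"
proof
  have "columns A \<subseteq> range ((*v) A)"
    by (auto simp: columns_image_basis)
  then show "colspan A \<subseteq> range ((*v) A)"
    unfolding colspan_def by (intro span_minimal linear_subspace_image) auto
  show "range ((*v) A) \<subseteq> colspan A"
    using matrix_vector_mult_in_columnspace unfolding colspan_def by blast
qed

text \<open>
  The $i$-th of the $k$ horizontal strips of a matrix or vector with $kn$ rows, so that
  the block matrix $(A_0|\cdots|A_{k-1})$ acts by summing $A_i$ times the $i$-th strip. The
  entries may be numbers, for vectors, or rows, for matrices.
\<close>

definition block_row :: "nat \<Rightarrow> 'a^('k::finite \<times> 'n::finite) \<Rightarrow> 'a^'n" where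
  "block_row i R = (\<chi> b. R $ (from_nat_into UNIV i, b))"

definition block_stack :: "(nat \<Rightarrow> 'a^'n) \<Rightarrow> 'a^('k::finite \<times> 'n::finite)" where
  "block_stack c = (\<chi> p. c (to_nat_on (UNIV :: 'k set) (fst p)) $ snd p)"

lemma block_index: "bij_betw (to_nat_on (UNIV :: 'k::finite set)) UNIV {..<CARD('k)}"
  by (rule to_nat_on_finite) simp

lemma block_row_stack:
  assumes "i < CARD('k::finite)"
  shows "block_row i (block_stack c :: 'a^('k \<times> 'n::finite)) = c i"
proof -
  have "i \<in> range (to_nat_on (UNIV :: 'k set))"
    using assms block_index by (auto simp: bij_betw_def)
  then show ?thesis
    by (simp add: block_row_def block_stack_def vec_eq_iff)
qed

lemma sum_block_index:
  fixes f :: "nat \<Rightarrow> 'n::finite \<Rightarrow> real"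
  shows "(\<Sum>p\<in>(UNIV :: ('k::finite \<times> 'n) set). f (to_nat_on (UNIV :: 'k set) (fst p)) (snd p))
     = (\<Sum>i<CARD('k). \<Sum>b\<in>UNIV. f i b)"
proof -
  have "(\<Sum>p\<in>(UNIV :: ('k \<times> 'n) set). f (to_nat_on (UNIV :: 'k set) (fst p)) (snd p))
     = (\<Sum>a\<in>(UNIV :: 'k set). \<Sum>b\<in>UNIV. f (to_nat_on UNIV a) b)"
    by (simp add: sum.cartesian_product UNIV_Times_UNIV case_prod_beta)
  also have "\<dots> = (\<Sum>i<CARD('k). \<Sum>b\<in>UNIV. f i b)"
    by (rule sum.reindex_bij_betw[OF block_index])
  finally show ?thesis .
qed

lemma block_matrix_mult:
  fixes As :: "nat \<Rightarrow> real^'n^('k::finite \<times> 'n::finite)"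
  shows "block_matrix As ** R = (\<Sum>i<CARD('k). As i ** block_row i R)"
proof -
  have "(block_matrix As ** R) $ r $ c
      = (\<Sum>i<CARD('k). \<Sum>b\<in>UNIV. As i $ r $ b * R $ (from_nat_into UNIV i, b) $ c)" for r c
    by (subst sum_block_index[symmetric])
       (simp add: matrix_matrix_mult_def block_matrix_def from_nat_into_to_nat_on)
  then show ?thesis
    by (simp add: vec_eq_iff matrix_matrix_mult_def block_row_def)
qed

lemma block_matrix_vector_mult:
  fixes As :: "nat \<Rightarrow> real^'n^('k::finite \<times> 'n::finite)"
  shows "block_matrix As *v x = (\<Sum>i<CARD('k). As i *v block_row i x)"
proof -
  have "(block_matrix As *v x) $ r
      = (\<Sum>i<CARD('k). \<Sum>b\<in>UNIV. As i $ r $ b * x $ (from_nat_into UNIV i, b))" for r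
    by (subst sum_block_index[symmetric])
       (simp add: matrix_vector_mult_def block_matrix_def from_nat_into_to_nat_on)
  then show ?thesis
    by (simp add: vec_eq_iff matrix_vector_mult_def block_row_def)
qed

lemma sum_blocks_eq:
  fixes As :: "nat \<Rightarrow> real^'n^('k::finite \<times> 'n::finite)"
  shows "(\<Sum>i<CARD('k). As i ** C i) = block_matrix As ** block_stack C"
    and "(\<Sum>i<CARD('k). As i *v c i) = block_matrix As *v block_stack c"
  by (simp_all add: block_matrix_mult block_matrix_vector_mult block_row_stack)

lemma block_matrix_left_mult: "T ** block_matrix As = block_matrix (\<lambda>i. T ** As i)"
  by (simp add: vec_eq_iff matrix_matrix_mult_def block_matrix_def)

lemma block_matrix_eq_iff:
  fixes As :: "nat \<Rightarrow> real^'n^('k::finite \<times> 'n::finite)"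
  shows "block_matrix As = block_matrix Bs \<longleftrightarrow> (\<forall>i<CARD('k). As i = Bs i)"
proof
  assume eq: "block_matrix As = block_matrix Bs"
  have "As (to_nat_on (UNIV :: 'k set) a) = Bs (to_nat_on (UNIV :: 'k set) a)" for a
    using eq by (simp add: block_matrix_def vec_eq_iff)
  then show "\<forall>i<CARD('k). As i = Bs i"
    using block_index[where 'k = 'k] by (metis bij_betw_def imageE lessThan_iff)
next
  assume eq: "\<forall>i<CARD('k). As i = Bs i"
  have "to_nat_on (UNIV :: 'k set) a < CARD('k)" for a
    using bij_betwE[OF block_index] by blast
  then show "block_matrix As = block_matrix Bs"
    using eq by (simp add: block_matrix_def vec_eq_iff)
qed

lemma fanning_tuples_iff: "As \<in> fanning_tuples \<longleftrightarrow> invertible (block_matrix As)"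
  by (simp add: fanning_tuples_def)

lemma invertible_cancel:
  assumes "invertible M"
  shows "M ** C = M ** D \<longleftrightarrow> C = (D :: real^'c^'b)" "M *v x = M *v y \<longleftrightarrow> x = (y :: real^'b)"
  by (metis matrix_inv_left[OF assms] matrix_mul_assoc matrix_mul_lid)
     (metis matrix_inv_left[OF assms] matrix_vector_mul_assoc matrix_vector_mul_lid)

lemma fanning_unique:
  fixes As :: "nat \<Rightarrow> real^'n^('k::finite \<times> 'n::finite)"
  assumes "As \<in> fanning_tuples"
    and "(\<Sum>i<CARD('k). As i *v c i) = (\<Sum>i<CARD('k). As i *v d i)" "i < CARD('k)"
  shows "c i = d i"
proof -
  have "block_stack c = (block_stack d :: real^('k \<times> 'n))"
    using assms by (simp add: sum_blocks_eq fanning_tuples_iff invertible_cancel)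
  then show ?thesis by (metis assms(3) block_row_stack)
qed

lemma fanning_expand:
  fixes As :: "nat \<Rightarrow> real^'n^('k::finite \<times> 'n::finite)"
  assumes "As \<in> fanning_tuples"
  obtains c where "x = (\<Sum>i<CARD('k). As i *v c i)"
proof
  show "x = (\<Sum>i<CARD('k). As i *v block_row i (matrix_inv (block_matrix As) *v x))"
    using assms unfolding block_matrix_vector_mult[symmetric]
    by (simp add: matrix_vector_mul_assoc matrix_inv_right fanning_tuples_iff)
qed

lemma fanning_expand_matrix:
  fixes As :: "nat \<Rightarrow> real^'n^('k::finite \<times> 'n::finite)"
  assumes "As \<in> fanning_tuples"
  obtains C where "B = (\<Sum>i<CARD('k). As i ** C i)"
proof
  show "B = (\<Sum>i<CARD('k). As i ** block_row i (matrix_inv (block_matrix As) ** B))"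
    using assms unfolding block_matrix_mult[symmetric]
    by (simp add: matrix_mul_assoc matrix_inv_right fanning_tuples_iff)
qed

lemma block_column_in_range:
  fixes As :: "nat \<Rightarrow> real^'n^('k::finite \<times> 'n::finite)"
  assumes "m < CARD('k)"
  shows "As m *v y \<in> range ((*v) (block_matrix As))"
proof -
  have "As m *v y = (\<Sum>i<CARD('k). As i *v (if i = m then y else 0))"
    using assms by (simp add: if_distrib[of "\<lambda>x. _ *v x"] cong: if_cong)
  then show ?thesis unfolding sum_blocks_eq by blast
qed

lemma subspace_matrix_range: "subspace (range ((*v) (M :: real^'b^'a)))"
  by (intro linear_subspace_image) auto

text \<open>
  A square matrix is invertible as soon as it is surjective. Most tuples below are recognised
  as fanning by checking that their columns generate those of a tuple known to be fanning.
\<close>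

lemma fanning_if_spanning:
  fixes As :: "nat \<Rightarrow> real^'n^('k::finite \<times> 'n::finite)"
  assumes Bs: "Bs \<in> fanning_tuples"
    and span: "\<And>i y. i < CARD('k) \<Longrightarrow> Bs i *v y \<in> range ((*v) (block_matrix As))"
  shows "As \<in> fanning_tuples"
proof -
  have "x \<in> range ((*v) (block_matrix As))" for x
  proof -
    obtain c where "x = (\<Sum>i<CARD('k). Bs i *v c i)" by (rule fanning_expand[OF Bs])
    then show ?thesis
      by (auto intro!: subspace_sum subspace_matrix_range span)
  qed
  then have "surj ((*v) (block_matrix As))" by blast
  then show ?thesis
    by (simp add: fanning_tuples_iff invertible_right_inverse matrix_right_invertible_surjective)
qed

text \<open>
  A fanning tuple is a block basis, so a linear map is determined by arbitrary images of the
  blocks; this is the map that sends one tuple to the other.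
\<close>

definition block_map ::
    "(nat \<Rightarrow> real^'n^('k::finite \<times> 'n::finite)) \<Rightarrow> (nat \<Rightarrow> real^'n^('k \<times> 'n)) \<Rightarrow>
     real^('k \<times> 'n)^('k \<times> 'n)" where
  "block_map As Bs = block_matrix Bs ** matrix_inv (block_matrix As)"

lemma block_map_unique:
  fixes As :: "nat \<Rightarrow> real^'n^('k::finite \<times> 'n::finite)"
  assumes "As \<in> fanning_tuples"
  shows "T = block_map As Bs \<longleftrightarrow> (\<forall>i<CARD('k). T ** As i = Bs i)"
proof -
  have "T = block_map As Bs \<longleftrightarrow> T ** block_matrix As = block_matrix Bs"
    using assms unfolding block_map_def fanning_tuples_iff
    by (metis matrix_inv_left matrix_inv_right matrix_mul_assoc matrix_mul_rid)
  then show ?thesis by (simp add: block_matrix_left_mult block_matrix_eq_iff)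
qed

lemma block_map_mult:
  fixes As :: "nat \<Rightarrow> real^'n^('k::finite \<times> 'n::finite)"
  assumes "As \<in> fanning_tuples" "i < CARD('k)"
  shows "block_map As Bs ** As i = Bs i"
  using assms block_map_unique by blast

lemma invertible_matrix_inv: "invertible M \<Longrightarrow> invertible (matrix_inv M)" for M :: "real^'a^'a"
  using matrix_inv_left[of M] matrix_inv_right[of M] unfolding invertible_def[of "matrix_inv M"]
  by blast

lemma invertible_block_map:
  assumes "As \<in> fanning_tuples" "Bs \<in> fanning_tuples"
  shows "invertible (block_map As Bs)"
  using assms unfolding block_map_def fanning_tuples_iff
  by (intro invertible_mult invertible_matrix_inv)

lemma fanning_left_mult:
  fixes As :: "nat \<Rightarrow> real^'n^('k::finite \<times> 'n::finite)" and T :: "real^('k \<times> 'n)^('k \<times> 'n)"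
  assumes "As \<in> fanning_tuples" "invertible T"
  shows "(\<lambda>i. T ** As i) \<in> fanning_tuples"
  using assms invertible_mult[of T "block_matrix As"]
  by (simp add: fanning_tuples_iff block_matrix_left_mult)

lemma fanning_cong:
  fixes As :: "nat \<Rightarrow> real^'n^('k::finite \<times> 'n::finite)"
  assumes "As \<in> fanning_tuples" "\<And>i. i < CARD('k) \<Longrightarrow> As i = Bs i"
  shows "Bs \<in> fanning_tuples"
  using assms by (metis block_matrix_eq_iff fanning_tuples_iff)

text \<open>
  The block matrix is a sum of constant linear functions of its blocks.
\<close>

lemma smooth_block_matrix:
  fixes f :: "nat \<Rightarrow> real \<Rightarrow> real^'n^('k::finite \<times> 'n::finite)"
  assumes "\<And>i. smooth_curve (f i)"
  shows "smooth_curve (\<lambda>t. block_matrix (\<lambda>i. f i t))"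
proof -
  define L where "L i B = block_matrix (\<lambda>j. if j = i then B else 0 :: real^'n^('k \<times> 'n))" for i B
  have L: "bounded_linear (L i)" for i
    by (auto intro!: linearI simp: linear_conv_bounded_linear[symmetric] L_def block_matrix_def vec_eq_iff)
  have "block_matrix As = (\<Sum>i<CARD('k). L i (As i))" for As
  proof -
    have "to_nat_on (UNIV :: 'k set) a < CARD('k)" for a
      using bij_betwE[OF block_index] by blast
    then show ?thesis
      by (simp add: L_def block_matrix_def vec_eq_iff if_distrib[of "\<lambda>x. x $ _"] cong: if_cong)
  qed
  then show ?thesis
    by (simp add: smooth_sum smooth_linear[OF L assms])
qed

section \<open>Jets of frames\<close>

text \<open>
  Both sides are sums over triples of orders with sum $m$; the coefficients agree since
  choosing $j$ and then $i$ out of $m$ amounts to choosing $i+j$ and then $j$ among them.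
\<close>

lemma jet_mult_assoc: "jet_mult (jet_mult As X) Y m = jet_mult As (jet_mult X Y) m"
proof -
  have "jet_mult (jet_mult As X) Y m =
    (\<Sum>j\<in>{0..m}. \<Sum>i\<in>{0..m-j}.
       (real (m choose j) * real (m - j choose i)) *\<^sub>R (As (m - j - i) ** X i ** Y j))"
    by (simp add: jet_mult_def mat_mult.sum_left mat_mult.scaleR_left scaleR_sum_right)
  also have "\<dots> = (\<Sum>q\<in>{0..m}. \<Sum>j\<in>{0..q}.
       (real (m choose q) * real (q choose j)) *\<^sub>R (As (m - q) ** X (q - j) ** Y j))"
  proof (simp add: sum.Sigma, rule sum.reindex_bij_witness[where
        i = "\<lambda>(q, j). (j, q - j)" and j = "\<lambda>(j, i). (i + j, j)"], goal_cases)
    case (5 a)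
    then obtain j i where a: "a = (j, i)" "j \<le> m" "i \<le> m - j" by auto
    have "(m choose (i + j)) * ((i + j) choose j) = (m choose j) * ((m - j) choose i)"
      using choose_mult[of j "i + j" m] a by simp
    then have "real (m choose (i + j)) * real ((i + j) choose j)
        = real (m choose j) * real ((m - j) choose i)"
      by (metis of_nat_mult)
    then show ?case using a by (simp add: add.commute)
  qed auto
  also have "\<dots> = jet_mult As (jet_mult X Y) m"
    by (simp add: jet_mult_def mat_mult.sum_right mat_mult.scaleR_right scaleR_sum_right
        matrix_mul_assoc)
  finally show ?thesis .
qed

definition jet_one :: "nat \<Rightarrow> real^'b^'b" where
  "jet_one m = (if m = 0 then mat 1 else 0)"

lemma jet_mult_one: "jet_mult As jet_one m = As m"
proof -
  have "jet_mult As jet_one m = (\<Sum>i=0..m. if i = 0 then As m else 0)"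
    unfolding jet_mult_def by (rule sum.cong) (auto simp: jet_one_def)
  then show ?thesis by simp
qed

lemma jet_mult_cong:
  assumes "\<And>i. i \<le> m \<Longrightarrow> As i = Bs i" "\<And>i. i \<le> m \<Longrightarrow> X i = Y i"
  shows "jet_mult As X m = jet_mult Bs Y m"
  unfolding jet_mult_def by (rule sum.cong) (use assms in auto)

lemma jet_mult_0: "jet_mult As X 0 = As 0 ** X 0"
  by (simp add: jet_mult_def)

text \<open>
  The recursion solves $X \cdot Y = 1$ order by order: the Leibniz formula of order $m$
  contains the unknown $Y_m$ only in the term $X_0 Y_m$.
\<close>

fun jet_inverse :: "(nat \<Rightarrow> real^'b^'b) \<Rightarrow> nat \<Rightarrow> real^'b^'b" where
  "jet_inverse X m = (if m = 0 then matrix_inv (X 0) else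
     - (matrix_inv (X 0) ** (\<Sum>i<m. real (m choose i) *\<^sub>R (X (m - i) ** jet_inverse X i))))"

declare jet_inverse.simps [simp del]

lemma jet_mult_inverse:
  assumes "invertible (X 0)"
  shows "jet_mult X (jet_inverse X) = jet_one"
proof
  fix m
  show "jet_mult X (jet_inverse X) m = jet_one m"
  proof (cases "m = 0")
    case True
    then show ?thesis
      by (simp add: jet_mult_0 jet_one_def jet_inverse.simps[of X 0] matrix_inv_right assms)
  next
    case False
    have "{0..m} = insert m {..<m}" by auto
    then have "jet_mult X (jet_inverse X) m = X 0 ** jet_inverse X m
       + (\<Sum>i<m. real (m choose i) *\<^sub>R (X (m - i) ** jet_inverse X i))"
      by (simp add: jet_mult_def)
    also have "X 0 ** jet_inverse X m
       = - (\<Sum>i<m. real (m choose i) *\<^sub>R (X (m - i) ** jet_inverse X i))"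
      using False
      by (simp add: jet_inverse.simps[of X m] mat_mult.minus_right matrix_mul_assoc
          matrix_inv_right assms)
    finally show ?thesis using False by (simp add: jet_one_def)
  qed
qed

lemma jet_mult_inverse_cancel:
  assumes "invertible (X 0)"
  shows "jet_mult (jet_mult As X) (jet_inverse X) m = As m"
  by (simp add: jet_mult_assoc jet_mult_inverse[of X, OF assms] jet_mult_one)

lemma jet_inverse_0: "invertible (X 0) \<Longrightarrow> invertible (jet_inverse X 0)"
  by (simp add: jet_inverse.simps[of X 0] invertible_matrix_inv)

text \<open>
  The action is undone by the inverse jet, so the old blocks are combinations of the new ones.
  Invertibility follows without writing the new block matrix as a triangular multiple of the
  old one.
\<close>

lemma fanning_jet_mult:
  fixes As :: "nat \<Rightarrow> real^'n^('k::finite \<times> 'n::finite)"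
  assumes As: "As \<in> fanning_tuples" and X: "invertible (X 0)"
  shows "jet_mult As X \<in> fanning_tuples"
proof (rule fanning_if_spanning[OF As])
  fix i y assume i: "i < CARD('k)"
  have "As i *v y = (\<Sum>j=0..i. real (i choose j) *\<^sub>R (jet_mult As X (i - j) *v (jet_inverse X j *v y)))"
    by (subst jet_mult_inverse_cancel[of X As i, OF X, symmetric], subst jet_mult_def)
       (simp add: mat_vec.sum_left mat_vec.scaleR_left matrix_vector_mul_assoc)
  then show "As i *v y \<in> range ((*v) (block_matrix (jet_mult As X)))"
    using i by (auto intro!: subspace_sum subspace_scale subspace_matrix_range block_column_in_range)
qed

lemma jet_relI:
  fixes As :: "nat \<Rightarrow> real^'n^('k::finite \<times> 'n::finite)"
  assumes "As \<in> fanning_tuples" "invertible (X 0)"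
    and "\<And>m. m \<le> CARD('k) \<Longrightarrow> Bs m = jet_mult As X m"
  shows "(As, Bs) \<in> jet_rel"
proof -
  have "Bs \<in> fanning_tuples"
    using fanning_cong[OF fanning_jet_mult[of As X]] assms by simp
  then show ?thesis
    using assms unfolding jet_rel_def by (auto simp: jet_mult_def)
qed

lemma jet_rel_iff:
  fixes As :: "nat \<Rightarrow> real^'n^('k::finite \<times> 'n::finite)"
  shows "(As, Bs) \<in> jet_rel \<longleftrightarrow> As \<in> fanning_tuples \<and> Bs \<in> fanning_tuples \<and>
    (\<exists>X. invertible (X 0) \<and> (\<forall>m\<le>CARD('k). Bs m = jet_mult As X m))"
  by (simp add: jet_rel_def jet_mult_def)

text \<open>
  The jets $X$ with invertible $X_0$ form a group under the Leibniz product.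
\<close>

lemma equiv_jet_rel:
  "equiv fanning_tuples (jet_rel :: ((nat \<Rightarrow> real^'n^('k::finite \<times> 'n::finite)) \<times> _) set)"
proof (rule equivI)
  show "jet_rel \<subseteq> fanning_tuples \<times> (fanning_tuples :: (nat \<Rightarrow> real^'n^('k \<times> 'n)) set)"
    by (auto simp: jet_rel_def)
  show "refl_on fanning_tuples (jet_rel :: ((nat \<Rightarrow> real^'n^('k \<times> 'n)) \<times> _) set)"
  proof (rule refl_onI)
    fix As :: "nat \<Rightarrow> real^'n^('k \<times> 'n)"
    assume "As \<in> fanning_tuples"
    moreover have "invertible (mat 1 :: real^'n^'n)"
      unfolding invertible_def by (metis matrix_mul_lid)
    ultimately show "(As, As) \<in> jet_rel"
      by (intro jet_relI[where X = jet_one]) (auto simp: jet_mult_one jet_one_def)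
  qed
  show "sym (jet_rel :: ((nat \<Rightarrow> real^'n^('k \<times> 'n)) \<times> _) set)"
  proof (rule symI)
    fix As Bs :: "nat \<Rightarrow> real^'n^('k \<times> 'n)"
    assume "(As, Bs) \<in> jet_rel"
    then obtain X where X: "As \<in> fanning_tuples" "Bs \<in> fanning_tuples" "invertible (X 0)"
      "\<And>m. m \<le> CARD('k) \<Longrightarrow> Bs m = jet_mult As X m"
      by (auto simp: jet_rel_iff)
    show "(Bs, As) \<in> jet_rel"
    proof (rule jet_relI)
      show "invertible (jet_inverse X 0)" using X by (simp add: jet_inverse_0)
      fix m assume "m \<le> CARD('k)"
      then show "As m = jet_mult Bs (jet_inverse X) m"
        using X(4) jet_mult_cong[of m Bs "jet_mult As X" "jet_inverse X" "jet_inverse X"]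
        by (simp add: jet_mult_inverse_cancel[of X, OF X(3)])
    qed (rule X(2))
  qed
  show "trans (jet_rel :: ((nat \<Rightarrow> real^'n^('k \<times> 'n)) \<times> _) set)"
  proof (rule transI)
    fix As Bs Cs :: "nat \<Rightarrow> real^'n^('k \<times> 'n)"
    assume rel: "(As, Bs) \<in> jet_rel" "(Bs, Cs) \<in> jet_rel"
    obtain X where X: "As \<in> fanning_tuples" "invertible (X 0)"
      "\<And>m. m \<le> CARD('k) \<Longrightarrow> Bs m = jet_mult As X m"
      using rel(1) by (auto simp: jet_rel_iff)
    obtain Y where Y: "invertible (Y 0)" "\<And>m. m \<le> CARD('k) \<Longrightarrow> Cs m = jet_mult Bs Y m"
      using rel(2) by (auto simp: jet_rel_iff)
    show "(As, Cs) \<in> jet_rel"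
    proof (rule jet_relI[where X = "jet_mult X Y"])
      show "invertible (jet_mult X Y 0)" using X Y by (simp add: jet_mult_0 invertible_mult)
      fix m assume "m \<le> CARD('k)"
      then show "Cs m = jet_mult As (jet_mult X Y) m"
        using X(3) Y(2) jet_mult_cong[of m Bs "jet_mult As X" Y Y] by (simp add: jet_mult_assoc)
    qed (rule X(1))
  qed
qed

lemma jet_class_eq:
  "(As, Bs) \<in> jet_rel \<Longrightarrow> jet_rel `` {As} = jet_rel `` {Bs}"
  using equiv_class_eq[OF equiv_jet_rel] .

section \<open>The fundamental endomorphism of a tuple\<close>

text \<open>
  The fundamental endomorphism of a tuple at one instant. At $i = 0$ the factor $i$ vanishes,
  so the truncated index $i - 1$ does no harm and $F A_0 = 0$ is included.
\<close>

definition tuple_endomorphism ::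
    "(nat \<Rightarrow> real^'n^('k::finite \<times> 'n::finite)) \<Rightarrow> real^('k \<times> 'n)^('k \<times> 'n)" where
  "tuple_endomorphism As = block_map As (\<lambda>i. real i *\<^sub>R As (i - 1))"

text \<open>
  If $P$ is the projection onto the vertical space, this is $(I - P) A^{(k-1)}$, and its columns
  span the kernel of $P$. It uses derivatives up to order $k$ only.
\<close>

definition horizontal_block ::
    "(nat \<Rightarrow> real^'n^('k::finite \<times> 'n::finite)) \<Rightarrow> real^'n^('k \<times> 'n)" where
  "horizontal_block As =
     As (CARD('k) - 1) - (1 / real CARD('k)) *\<^sub>R (tuple_endomorphism As ** As CARD('k))"

lemma tuple_endomorphism_mult:
  fixes As :: "nat \<Rightarrow> real^'n^('k::finite \<times> 'n::finite)"
  assumes "As \<in> fanning_tuples" "i < CARD('k)"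
  shows "tuple_endomorphism As ** As i = real i *\<^sub>R As (i - 1)"
  unfolding tuple_endomorphism_def by (rule block_map_mult[OF assms])

text \<open>
  $F$ acts on the blocks as differentiation acts on powers, and the identity
  $(m-i)\binom{m}{i} = m\binom{m-1}{i}$ makes this compatible with the Leibniz product. If the
  relation $F A_i = i A_{i-1}$ is known below $m$, its
  defect at $m$ is affected only by the value $X_0$ of the jet $X$. For $m < k$ the defect
  vanishes, which makes $F$ independent of the frame; for $m = k$ the defect is a multiple of
  the horizontal block, which therefore spans the same space for all frames.
\<close>

lemma endomorphism_jet_mult:
  assumes F: "\<And>i. i < m \<Longrightarrow> F ** As i = real i *\<^sub>R As (i - 1)"
  shows "F ** jet_mult As X m - real m *\<^sub>R jet_mult As X (m - 1)
       = (F ** As m - real m *\<^sub>R As (m - 1)) ** X 0"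
proof -
  define E where "E = F ** As m - real m *\<^sub>R As (m - 1)"
  have F': "F ** As (m - i) = real (m - i) *\<^sub>R As (m - 1 - i) + (if i = 0 then E else 0)" if "i \<le> m" for i
    using F[of "m - i"] that by (cases "i = 0") (auto simp: E_def)
  have "F ** jet_mult As X m = (\<Sum>i=0..m. real (m choose i) *\<^sub>R (F ** As (m - i) ** X i))"
    by (simp add: jet_mult_def mat_mult.sum_right mat_mult.scaleR_right matrix_mul_assoc)
  also have "\<dots> = (\<Sum>i=0..m. real ((m - i) * (m choose i)) *\<^sub>R (As (m - 1 - i) ** X i)
      + (if i = 0 then E ** X 0 else 0))"
  proof (rule sum.cong)
    fix i assume "i \<in> {0..m}"
    then show "real (m choose i) *\<^sub>R (F ** As (m - i) ** X i)
       = real ((m - i) * (m choose i)) *\<^sub>R (As (m - 1 - i) ** X i) + (if i = 0 then E ** X 0 else 0)"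
      by (simp add: F' mat_mult.add_left mat_mult.scaleR_left scaleR_add_right mult.commute
          del: of_nat_diff)
  qed simp
  also have "\<dots> = (\<Sum>i=0..m. real ((m - i) * (m choose i)) *\<^sub>R (As (m - 1 - i) ** X i)) + E ** X 0"
    by (simp add: sum.distrib)
  also have "(\<Sum>i=0..m. real ((m - i) * (m choose i)) *\<^sub>R (As (m - 1 - i) ** X i))
      = real m *\<^sub>R jet_mult As X (m - 1)"
  proof (cases m)
    case (Suc p)
    have "(\<Sum>i=0..m. real ((m - i) * (m choose i)) *\<^sub>R (As (m - 1 - i) ** X i))
        = (\<Sum>i=0..p. real ((m - i) * (m choose i)) *\<^sub>R (As (m - 1 - i) ** X i))"
      by (simp add: Suc)
    also have "\<dots> = real m *\<^sub>R jet_mult As X (m - 1)"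
      unfolding jet_mult_def scaleR_sum_right binomial_absorb_comp
      by (simp add: Suc algebra_simps)
    finally show ?thesis .
  qed simp
  finally show ?thesis by (simp add: E_def)
qed

lemma tuple_endomorphism_jet_mult:
  fixes As :: "nat \<Rightarrow> real^'n^('k::finite \<times> 'n::finite)"
  assumes "As \<in> fanning_tuples" "invertible (X 0)"
  shows "tuple_endomorphism (jet_mult As X) = tuple_endomorphism As"
proof -
  have "tuple_endomorphism As ** jet_mult As X m = real m *\<^sub>R jet_mult As X (m - 1)"
    if "m < CARD('k)" for m
    using endomorphism_jet_mult[of m "tuple_endomorphism As" As X] that
      tuple_endomorphism_mult[OF assms(1)] by simp
  then have "tuple_endomorphism As
      = block_map (jet_mult As X) (\<lambda>i. real i *\<^sub>R jet_mult As X (i - 1))"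
    by (subst block_map_unique[OF fanning_jet_mult[of As X, OF assms]]) blast
  then show ?thesis
    by (simp add: tuple_endomorphism_def[of "jet_mult As X"])
qed

lemma horizontal_block_altdef:
  fixes As :: "nat \<Rightarrow> real^'n^('k::finite \<times> 'n::finite)"
  shows "horizontal_block As = - (1 / real CARD('k)) *\<^sub>R
    (tuple_endomorphism As ** As CARD('k) - real CARD('k) *\<^sub>R As (CARD('k) - 1))"
  by (simp add: horizontal_block_def algebra_simps)

lemma horizontal_block_jet_mult:
  fixes As :: "nat \<Rightarrow> real^'n^('k::finite \<times> 'n::finite)"
  assumes "As \<in> fanning_tuples" "invertible (X 0)"
  shows "horizontal_block (jet_mult As X) = horizontal_block As ** X 0"
  unfolding horizontal_block_altdef tuple_endomorphism_jet_mult[of As X, OF assms]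
  by (subst endomorphism_jet_mult)
     (use tuple_endomorphism_mult[OF assms(1)] in \<open>auto simp: mat_mult.scaleR_left mat_mult.minus_left\<close>)

lemma tuple_endomorphism_cong:
  fixes As :: "nat \<Rightarrow> real^'n^('k::finite \<times> 'n::finite)"
  assumes "\<And>i. i < CARD('k) \<Longrightarrow> As i = Bs i"
  shows "tuple_endomorphism As = tuple_endomorphism Bs"
proof -
  have "block_matrix As = block_matrix Bs"
    "block_matrix (\<lambda>i. real i *\<^sub>R As (i - 1)) = block_matrix (\<lambda>i. real i *\<^sub>R Bs (i - 1))"
    using assms by (auto simp: block_matrix_eq_iff)
  then show ?thesis by (simp add: tuple_endomorphism_def block_map_def)
qed

lemma horizontal_block_cong:
  fixes As :: "nat \<Rightarrow> real^'n^('k::finite \<times> 'n::finite)"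
  assumes "\<And>i. i \<le> CARD('k) \<Longrightarrow> As i = Bs i"
  shows "horizontal_block As = horizontal_block Bs"
  using assms tuple_endomorphism_cong[of As Bs] by (simp add: horizontal_block_def)

text \<open>
  Conjugation by $T$ carries the fundamental endomorphism of a tuple to that of its image,
  because it satisfies the defining relations.
\<close>

lemma horizontal_block_left_mult:
  fixes As :: "nat \<Rightarrow> real^'n^('k::finite \<times> 'n::finite)" and T :: "real^('k \<times> 'n)^('k \<times> 'n)"
  assumes As: "As \<in> fanning_tuples" and T: "invertible T"
  shows "horizontal_block (\<lambda>i. T ** As i) = T ** horizontal_block As"
proof -
  let ?G = "T ** tuple_endomorphism As ** matrix_inv T"
  have TT: "matrix_inv T ** (T ** B) = B" for B :: "real^'n^('k \<times> 'n)"
    by (simp add: matrix_mul_assoc matrix_inv_left T)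
  have G: "?G ** (T ** B) = T ** (tuple_endomorphism As ** B)" for B :: "real^'n^('k \<times> 'n)"
    unfolding matrix_mul_assoc[symmetric] TT ..
  have "?G = tuple_endomorphism (\<lambda>i. T ** As i)"
    unfolding tuple_endomorphism_def[of "\<lambda>i. T ** As i"] block_map_unique[OF fanning_left_mult[OF As T]]
    using As by (simp add: G tuple_endomorphism_mult mat_mult.scaleR_right)
  then have "tuple_endomorphism (\<lambda>i. T ** As i) ** (T ** As CARD('k))
     = T ** (tuple_endomorphism As ** As CARD('k))"
    using G by metis
  then show ?thesis
    by (simp add: horizontal_block_def mat_mult.diff_right mat_mult.scaleR_right)
qed

text \<open>
  $F$ takes values in the vertical space. This is why subtracting a multiple of $F A^{(k)}$ from
  $A^{(k-1)}$ does not change the component along $A^{(k-1)}$.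
\<close>

lemma tuple_endomorphism_range:
  fixes As :: "nat \<Rightarrow> real^'n^('k::finite \<times> 'n::finite)"
  assumes "As \<in> fanning_tuples"
  obtains d where "tuple_endomorphism As *v x = (\<Sum>i<CARD('k) - 1. As i *v d i)"
proof -
  obtain c where c: "x = (\<Sum>i<CARD('k). As i *v c i)" by (rule fanning_expand[OF assms])
  have "tuple_endomorphism As *v x = (\<Sum>i<CARD('k). (tuple_endomorphism As ** As i) *v c i)"
    by (simp add: c mat_vec.sum_right matrix_vector_mul_assoc)
  also have "\<dots> = (\<Sum>i<Suc (CARD('k) - 1). real i *\<^sub>R (As (i - 1) *v c i))"
    using tuple_endomorphism_mult[OF assms] by (simp add: mat_vec.scaleR_left)
  also have "\<dots> = (\<Sum>i<CARD('k) - 1. As i *v (real (Suc i) *\<^sub>R c (Suc i)))"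
    by (subst sum.lessThan_Suc_shift) (simp add: mat_vec.scaleR_right)
  finally show ?thesis by (rule that)
qed

section \<open>The horizontal curve in terms of a frame\<close>

abbreviation derivatives :: "(real \<Rightarrow> 'a::real_normed_vector) \<Rightarrow> real \<Rightarrow> nat \<Rightarrow> 'a" where
  "derivatives A t \<equiv> \<lambda>i. vderiv i A t"

lemma fanning_frameD:
  assumes "fanning_frame A"
  shows "smooth_curve A" "derivatives A t \<in> fanning_tuples"
  using assms by (simp_all add: fanning_frame_def fanning_tuples_iff)

lemma fanning_frameI:
  assumes "smooth_curve A" "\<And>t. derivatives A t \<in> fanning_tuples"
  shows "fanning_frame A"
  using assms by (simp add: fanning_frame_def fanning_tuples_iff)

lemma block_row_mult: "block_row i (R ** Y) = block_row i R ** Y"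
  by (simp add: block_row_def matrix_matrix_mult_def vec_eq_iff)

lemma first_block_coefficients:
  fixes As :: "nat \<Rightarrow> real^'n^('k::finite \<times> 'n::finite)"
  assumes "As \<in> fanning_tuples"
  shows "block_row 0 (matrix_inv (block_matrix As) ** (As 0 ** Y)) = Y"
proof -
  have "As 0 = (\<Sum>i<CARD('k). if i = 0 then As i else 0)"
    by simp
  also have "\<dots> = (\<Sum>i<CARD('k). As i ** jet_one i)"
    by (rule sum.cong) (auto simp: jet_one_def)
  also have "\<dots> = block_matrix As ** block_stack jet_one"
    by (rule sum_blocks_eq)
  finally have "matrix_inv (block_matrix As) ** As 0 = (block_stack jet_one :: real^'n^('k \<times> 'n))"
    using assms by (simp add: fanning_tuples_iff matrix_mul_assoc matrix_inv_left)
  then show ?thesis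
    by (simp add: matrix_mul_assoc block_row_mult block_row_stack jet_one_def)
qed

lemma factor_through_colspan:
  fixes A :: "real^'b^'a" and B :: "real^'c^'a"
  assumes "colspan B \<subseteq> colspan A"
  obtains Y where "B = A ** Y"
proof -
  have "\<forall>j. \<exists>y. B *v axis j 1 = A *v y"
    using assms by (auto simp: colspan_eq_range)
  then obtain y where y: "\<And>j. B *v axis j 1 = A *v y j" by metis
  have "B $ i $ j = (A *v y j) $ i" for i j
    using y[of j] by (simp add: matrix_vector_mult_basis column_def vec_eq_iff)
  then have "B = A ** (\<chi> a j. y j $ a)"
    by (simp add: vec_eq_iff matrix_matrix_mult_def matrix_vector_mult_def)
  then show ?thesis by (rule that)
qed

text \<open>
  Two frames of one curve differ by a matrix $X$ at each instant. Completing the first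
  frame to the invertible matrix $M = (A|\cdots|A^{(k-1)})$ expresses $X$ as the first strip of
  $M^{-1} B$, and this formula shows that $X$ is smooth.
\<close>

lemma frame_change:
  fixes A B :: "real \<Rightarrow> real^'n^('k::finite \<times> 'n::finite)"
  assumes A: "fanning_frame A" and B: "smooth_curve B"
    and span: "\<And>t. colspan (B t) = colspan (A t)"
  obtains X where "smooth_curve X" "\<And>t. invertible (X t)" "B = (\<lambda>t. A t ** X t)"
proof
  define M where "M t = block_matrix (derivatives A t)" for t
  define X where "X t = block_row 0 (matrix_inv (M t) ** B t)" for t
  (* The first strip is a left inverse of A, which lets A be cancelled from both sides. *)
  have coeff: "block_row 0 (matrix_inv (M t) ** (A t ** Y)) = Y" for t Y
    using first_block_coefficients[OF fanning_frameD(2)[OF A], of t Y] by (simp add: M_def)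
  have BX: "B t = A t ** X t" for t
  proof -
    obtain Y where "B t = A t ** Y"
      using factor_through_colspan span by blast
    then show ?thesis by (simp add: X_def coeff)
  qed
  then show "B = (\<lambda>t. A t ** X t)" by blast
  show "invertible (X t)" for t
  proof -
    obtain Y where "A t = B t ** Y"
      using factor_through_colspan span by (metis order_refl)
    then have "A t ** (X t ** Y) = A t ** mat 1"
      by (simp add: BX matrix_mul_assoc)
    then have "X t ** Y = mat 1" by (metis coeff)
    then show ?thesis unfolding invertible_right_inverse by blast
  qed
  have "linear (block_row 0 :: real^'n^('k \<times> 'n) \<Rightarrow> real^'n^'n)"
    by (intro linearI) (simp_all add: block_row_def vec_eq_iff)
  then have "bounded_linear (block_row 0 :: real^'n^('k \<times> 'n) \<Rightarrow> real^'n^'n)"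
    by (simp add: linear_conv_bounded_linear)
  moreover have "smooth_curve M" "\<And>t. invertible (M t)"
    unfolding M_def using A fanning_frameD(2)[OF A]
    by (auto intro!: smooth_block_matrix smooth_vderiv fanning_frameD(1)[OF A] simp: fanning_tuples_iff)
  ultimately show "smooth_curve X"
    unfolding X_def
    by (intro smooth_linear[of "block_row 0"] smooth_matrix_mult smooth_matrix_inv B)
qed

lemma derivatives_frame_change:
  fixes A B :: "real \<Rightarrow> real^'n^('k::finite \<times> 'n::finite)"
  assumes "fanning_frame A" "smooth_curve B" "spans_curve A l" "spans_curve B l"
  obtains X where "invertible (X 0)" "derivatives B t = jet_mult (derivatives A t) X"
proof -
  obtain X where X: "smooth_curve X" "\<And>t. invertible (X t)" "B = (\<lambda>t. A t ** X t)"
    using frame_change[of A B] assms by (metis spans_curve_def)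
  show ?thesis
  proof
    show "invertible (derivatives X t 0)" using X(2) by simp
    show "derivatives B t = jet_mult (derivatives A t) (derivatives X t)"
      unfolding X(3) vderiv_matrix_mult[OF fanning_frameD(1)[OF assms(1)] X(1)] ..
  qed
qed

lemma fanning_frame_if_spans:
  fixes A B :: "real \<Rightarrow> real^'n^('k::finite \<times> 'n::finite)"
  assumes "fanning_frame A" "smooth_curve B" "spans_curve A l" "spans_curve B l"
  shows "fanning_frame B"
proof (rule fanning_frameI)
  fix t
  obtain X where "invertible (X 0)" "derivatives B t = jet_mult (derivatives A t) X"
    using assms by (rule derivatives_frame_change)
  then show "derivatives B t \<in> fanning_tuples"
    using fanning_jet_mult[OF fanning_frameD(2)[OF assms(1)]] by simp
qed (rule assms(2))

lemma is_fundamental_endomorphism_iff: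
  fixes A :: "real \<Rightarrow> real^'n^('k::finite \<times> 'n::finite)"
  assumes "fanning_frame A"
  shows "is_fundamental_endomorphism A t F \<longleftrightarrow> F = tuple_endomorphism (derivatives A t)"
proof -
  have "{..<CARD('k)} = insert 0 {1..CARD('k) - 1}"
    using zero_less_card_finite[where 'a = 'k] by fastforce
  then have "(\<forall>i<CARD('k). F ** vderiv i A t = real i *\<^sub>R vderiv (i - 1) A t)
     \<longleftrightarrow> (\<forall>i\<in>insert 0 {1..CARD('k) - 1}. F ** vderiv i A t = real i *\<^sub>R vderiv (i - 1) A t)"
    by (metis lessThan_iff)
  then show ?thesis
    unfolding tuple_endomorphism_def block_map_unique[OF fanning_frameD(2)[OF assms]]
    by (simp add: is_fundamental_endomorphism_def)
qed

text \<open>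
  A change of frame acts on the derivatives by a Leibniz product, which does not alter $F$. So one
  endomorphism satisfies the relations for all frames, and the invertibility of a single block
  matrix makes it unique.
\<close>

lemma fundamental_endomorphism_eq:
  fixes A :: "real \<Rightarrow> real^'n^('k::finite \<times> 'n::finite)"
  assumes A: "fanning_frame A" "spans_curve A l"
  shows "fundamental_endomorphism l t = tuple_endomorphism (derivatives A t)"
  unfolding fundamental_endomorphism_def
proof (rule the_equality)
  show "\<forall>B. fanning_frame B \<and> spans_curve B l \<longrightarrow>
      is_fundamental_endomorphism B t (tuple_endomorphism (derivatives A t))"
  proof (intro allI impI)
    fix B :: "real \<Rightarrow> real^'n^('k \<times> 'n)"
    assume B: "fanning_frame B \<and> spans_curve B l"
    then obtain X where "invertible (X 0)" "derivatives B t = jet_mult (derivatives A t) X"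
      using derivatives_frame_change[of A B l] A fanning_frameD(1) by blast
    then show "is_fundamental_endomorphism B t (tuple_endomorphism (derivatives A t))"
      using B A by (simp add: is_fundamental_endomorphism_iff tuple_endomorphism_jet_mult fanning_frameD)
  qed
  fix F
  assume "\<forall>B. fanning_frame B \<and> spans_curve B l \<longrightarrow> is_fundamental_endomorphism B t F"
  with A have "is_fundamental_endomorphism A t F" by simp
  then show "F = tuple_endomorphism (derivatives A t)"
    by (simp add: is_fundamental_endomorphism_iff[OF A(1)])
qed

lemma smooth_tuple_endomorphism:
  fixes A :: "real \<Rightarrow> real^'n^('k::finite \<times> 'n::finite)"
  assumes A: "fanning_frame A"
  shows "smooth_curve (\<lambda>t. tuple_endomorphism (derivatives A t))"
proof -
  have d: "smooth_curve (vderiv i A)" for i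
    using fanning_frameD(1)[OF A] by (rule smooth_vderiv)
  have "smooth_curve (\<lambda>t. block_matrix (\<lambda>i. real i *\<^sub>R vderiv (i - 1) A t))"
    by (intro smooth_block_matrix smooth_linear[OF bounded_linear_scaleR_right d])
  moreover have "smooth_curve (\<lambda>t. matrix_inv (block_matrix (derivatives A t)))"
    by (intro smooth_matrix_inv smooth_block_matrix d)
       (use fanning_frameD(2)[OF A] in \<open>simp add: fanning_tuples_iff\<close>)
  ultimately show ?thesis
    unfolding tuple_endomorphism_def block_map_def by (rule smooth_matrix_mult)
qed

text \<open>
  Differentiate $F A^{(i)} = i A^{(i-1)}$.
\<close>

lemma fundamental_endomorphism_derivative:
  fixes A :: "real \<Rightarrow> real^'n^('k::finite \<times> 'n::finite)"
  assumes A: "fanning_frame A" "spans_curve A l" and i: "i < CARD('k)"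
  shows "vector_derivative (fundamental_endomorphism l) (at t) ** vderiv i A t
     = real i *\<^sub>R vderiv i A t - tuple_endomorphism (derivatives A t) ** vderiv (Suc i) A t"
proof -
  define F where "F = (\<lambda>t. tuple_endomorphism (derivatives A t))"
  have Fl: "fundamental_endomorphism l = F"
    using fundamental_endomorphism_eq[OF A] by (simp add: F_def fun_eq_iff)
  have dA: "(vderiv j A has_vector_derivative vderiv (Suc j) A t) (at t)" for j
    by (rule smooth_curve_has_vector_derivative[OF fanning_frameD(1)[OF A(1)]])
  have "smooth_curve F"
    using smooth_tuple_endomorphism[OF A(1)] by (simp add: F_def)
  then have "(F has_vector_derivative vector_derivative F (at t)) (at t)"
    using smooth_curve_has_vector_derivative[of F 0 t] by simp
  then have d1: "((\<lambda>t. F t ** vderiv i A t) has_vector_derivative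
      F t ** vderiv (Suc i) A t + vector_derivative F (at t) ** vderiv i A t) (at t)"
    by (rule mat_mult.has_vector_derivative[OF _ dA])
  have "(\<lambda>t. F t ** vderiv i A t) = (\<lambda>t. real i *\<^sub>R vderiv (i - 1) A t)"
    unfolding F_def using tuple_endomorphism_mult[OF fanning_frameD(2)[OF A(1)] i] by simp
  moreover have "((\<lambda>t. real i *\<^sub>R vderiv (i - 1) A t) has_vector_derivative real i *\<^sub>R vderiv i A t) (at t)"
    using bounded_linear.has_vector_derivative[OF bounded_linear_scaleR_right dA[of "i - 1"]]
    by (cases "i = 0") simp_all
  ultimately have "((\<lambda>t. F t ** vderiv i A t) has_vector_derivative real i *\<^sub>R vderiv i A t) (at t)"
    by simp
  with d1 have "F t ** vderiv (Suc i) A t + vector_derivative F (at t) ** vderiv i A t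
      = real i *\<^sub>R vderiv i A t"
    by (rule vector_derivative_unique_at)
  then show ?thesis by (simp add: Fl F_def algebra_simps)
qed

text \<open>
  For $i < k - 1$ the relation $F A^{(i+1)} = (i+1) A^{(i)}$ turns $\dot F A^{(i)}$ into
  $- A^{(i)}$, so $P$ fixes the vertical blocks. For $i = k - 1$ the derivative $A^{(k)}$ appears,
  and $P A^{(k-1)} = \frac1k F A^{(k)}$.
\<close>

lemma vertical_projection_mult:
  fixes A :: "real \<Rightarrow> real^'n^('k::finite \<times> 'n::finite)"
  assumes A: "fanning_frame A" "spans_curve A l" and i: "i < CARD('k)"
  shows "vertical_projection l t ** vderiv i A t
    = (if i = CARD('k) - 1 then vderiv i A t - horizontal_block (derivatives A t)
       else vderiv i A t)"
proof -
  let ?k = "real CARD('k)" and ?F = "tuple_endomorphism (derivatives A t)"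
  have k: "?k > 0" by simp
  have "vertical_projection l t ** vderiv i A t
     = (1/2) *\<^sub>R (vderiv i A t - (1 / ?k) *\<^sub>R (2 *\<^sub>R (real i *\<^sub>R vderiv i A t - ?F ** vderiv (Suc i) A t)
          - (?k - 2) *\<^sub>R vderiv i A t))"
    unfolding vertical_projection_def D_endomorphism_def
      fundamental_endomorphism_derivative[OF A i, symmetric]
    by (simp only: mat_mult.scaleR_left mat_mult.diff_left matrix_mul_lid)
  also have "\<dots> = (1 - (real i + 1) / ?k) *\<^sub>R vderiv i A t + (1 / ?k) *\<^sub>R (?F ** vderiv (Suc i) A t)"
    using k by (simp add: algebra_simps scaleR_add_left[symmetric] diff_divide_distrib add_divide_distrib del: scaleR_add_left)
  finally have P: "vertical_projection l t ** vderiv i A t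
     = (1 - (real i + 1) / ?k) *\<^sub>R vderiv i A t + (1 / ?k) *\<^sub>R (?F ** vderiv (Suc i) A t)" .
  show ?thesis
  proof (cases "i = CARD('k) - 1")
    case True
    then have "Suc i = CARD('k)" "real i + 1 = ?k" using i by auto
    with P True show ?thesis
      unfolding horizontal_block_def by simp
  next
    case False
    then have F: "?F ** vderiv (Suc i) A t = (real i + 1) *\<^sub>R vderiv i A t"
      using tuple_endomorphism_mult[OF fanning_frameD(2)[OF A(1)], of "Suc i" t] i by (simp add: add.commute)
    have "vertical_projection l t ** vderiv i A t
       = (1 - (real i + 1) / ?k + (1 / ?k) * (real i + 1)) *\<^sub>R vderiv i A t"
      by (simp only: P F scaleR_scaleR scaleR_left_distrib[symmetric])
    also have "1 - (real i + 1) / ?k + (1 / ?k) * (real i + 1) = 1"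
      by simp
    finally show ?thesis using False by simp
  qed
qed

lemma sum_split_last_block:
  "(\<Sum>i<CARD('k::finite). f i) = (\<Sum>i<CARD('k) - 1. f i) + f (CARD('k) - 1)"
proof -
  have "CARD('k) = Suc (CARD('k) - 1)" by simp
  then show ?thesis by (metis sum.lessThan_Suc)
qed

lemma horizontal_block_expand:
  fixes As :: "nat \<Rightarrow> real^'n^('k::finite \<times> 'n::finite)"
  assumes "As \<in> fanning_tuples"
  obtains d where "horizontal_block As *v y = (\<Sum>i<CARD('k) - 1. As i *v d i) + As (CARD('k) - 1) *v y"
proof -
  obtain d where d: "tuple_endomorphism As *v (As CARD('k) *v y) = (\<Sum>i<CARD('k) - 1. As i *v d i)"
    by (rule tuple_endomorphism_range[OF assms])
  have "horizontal_block As *v y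
     = As (CARD('k) - 1) *v y - (1 / real CARD('k)) *\<^sub>R (\<Sum>i<CARD('k) - 1. As i *v d i)"
    unfolding d[symmetric]
    by (simp add: horizontal_block_def mat_vec.diff_left mat_vec.scaleR_left matrix_vector_mul_assoc)
  also have "\<dots> = (\<Sum>i<CARD('k) - 1. As i *v (- (1 / real CARD('k)) *\<^sub>R d i)) + As (CARD('k) - 1) *v y"
    by (simp add: mat_vec.scaleR_right scaleR_sum_right sum_negf mat_vec.minus_right)
  finally show ?thesis by (rule that)
qed

lemma fanning_unique_last:
  fixes As :: "nat \<Rightarrow> real^'n^('k::finite \<times> 'n::finite)"
  assumes "As \<in> fanning_tuples"
    and "(\<Sum>i<CARD('k) - 1. As i *v c i) + As (CARD('k) - 1) *v y
       = (\<Sum>i<CARD('k) - 1. As i *v d i) + As (CARD('k) - 1) *v z"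
  shows "y = z"
proof -
  have *: "(\<Sum>i<CARD('k). As i *v (if i = CARD('k) - 1 then y else c i))
    = (\<Sum>i<CARD('k) - 1. As i *v c i) + As (CARD('k) - 1) *v y" for c y
    by (subst sum_split_last_block) simp
  show ?thesis
    using fanning_unique[OF assms(1), of "\<lambda>i. if i = CARD('k) - 1 then y else c i"
        "\<lambda>i. if i = CARD('k) - 1 then z else d i" "CARD('k) - 1"] assms(2)
    by (simp add: * del: One_nat_def)
qed

lemma horizontal_block_inj:
  assumes "As \<in> fanning_tuples"
  shows "inj ((*v) (horizontal_block As))"
proof (rule injI)
  fix y z assume eq: "horizontal_block As *v y = horizontal_block As *v z"
  obtain c where c: "horizontal_block As *v y = (\<Sum>i<CARD('b) - 1. As i *v c i) + As (CARD('b) - 1) *v y"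
    by (rule horizontal_block_expand[OF assms])
  obtain d where d: "horizontal_block As *v z = (\<Sum>i<CARD('b) - 1. As i *v d i) + As (CARD('b) - 1) *v z"
    by (rule horizontal_block_expand[OF assms])
  show "y = z"
    by (rule fanning_unique_last[OF assms, of c y d z]) (use eq c d in simp)
qed

lemma colspan_in_grassmannian:
  fixes B :: "real^'n^('k::finite \<times> 'n::finite)"
  assumes "inj ((*v) B)"
  shows "colspan B \<in> grassmannian"
proof -
  have "dim (range ((*v) B)) = dim (UNIV :: (real^'n) set)"
    by (rule dim_image_eq) (use assms in auto)
  then show ?thesis
    by (simp add: grassmannian_def colspan_eq_range subspace_matrix_range)
qed

text \<open>
  The kernel of the projection $P$ is the image of $I - P$. The vertical blocks are annihilated
  by $I - P$, so this image is spanned by $(I - P) A^{(k-1)}$.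
\<close>

lemma horizontal_curve_eq:
  fixes A :: "real \<Rightarrow> real^'n^('k::finite \<times> 'n::finite)"
  assumes A: "fanning_frame A" "spans_curve A l"
  shows "horizontal_curve l t = colspan (horizontal_block (derivatives A t))"
proof -
  let ?P = "vertical_projection l t" and ?B = "horizontal_block (derivatives A t)"
  note fan = fanning_frameD(2)[OF A(1), of t]
  have P: "?P *v (\<Sum>i<CARD('k). vderiv i A t *v c i)
      = (\<Sum>i<CARD('k). vderiv i A t *v c i) - ?B *v c (CARD('k) - 1)" for c
    unfolding sum_split_last_block
    using vertical_projection_mult[OF A]
    by (simp add: mat_vec.add_right mat_vec.sum_right matrix_vector_mul_assoc mat_vec.diff_left)
  have "?P *v (?B *v y) = 0" for y
  proof -
    obtain d where d: "?B *v y = (\<Sum>i<CARD('k) - 1. vderiv i A t *v d i) + vderiv (CARD('k) - 1) A t *v y"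
      by (rule horizontal_block_expand[OF fan])
    have "?B *v y = (\<Sum>i<CARD('k). vderiv i A t *v (if i = CARD('k) - 1 then y else d i))"
      unfolding d by (subst sum_split_last_block) simp
    then show ?thesis using P by simp
  qed
  moreover have "x \<in> range ((*v) ?B)" if "?P *v x = 0" for x
  proof -
    obtain c where "x = (\<Sum>i<CARD('k). vderiv i A t *v c i)" by (rule fanning_expand[OF fan])
    with P[of c] that have "x = ?B *v c (CARD('k) - 1)" by simp
    then show ?thesis by blast
  qed
  ultimately show ?thesis
    unfolding horizontal_curve_def colspan_eq_range by blast
qed

section \<open>The four properties of the horizontal curve\<close>

lemma colspan_mult_left: "colspan (T ** A) = (*v) T ` colspan A" for A :: "real^'b^'a"
  by (simp add: colspan_eq_range image_image matrix_vector_mul_assoc)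

lemma colspan_mult_right:
  fixes A :: "real^'b^'a" and X :: "real^'b^'b"
  assumes "invertible X"
  shows "colspan (A ** X) = colspan A"
proof -
  have "surj ((*v) X)"
    using assms by (simp add: invertible_right_inverse matrix_right_invertible_surjective)
  then have "range (\<lambda>y. A *v (X *v y)) = range ((*v) A)"
    by (metis image_image)
  then show ?thesis
    by (simp add: colspan_eq_range matrix_vector_mul_assoc)
qed

lemma grassmannian_assignment_horizontal:
  "grassmannian_assignment (horizontal_curve :: ('k::finite, 'n::finite) assignment)"
  unfolding grassmannian_assignment_def smooth_grassmannian_curve_def
proof (intro allI impI conjI)
  fix l :: "real \<Rightarrow> (real^('k \<times> 'n)) set"
  assume "fanning_curve l"
  then obtain A :: "real \<Rightarrow> real^'n^('k \<times> 'n)" where A: "fanning_frame A" "spans_curve A l"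
    by (auto simp: fanning_curve_def)
  let ?B = "\<lambda>t. horizontal_block (derivatives A t)"
  show "horizontal_curve l t \<in> grassmannian" for t
    unfolding horizontal_curve_eq[OF A]
    by (intro colspan_in_grassmannian horizontal_block_inj fanning_frameD(2) A)
  have d: "smooth_curve (vderiv i A)" for i
    using fanning_frameD(1)[OF A(1)] by (rule smooth_vderiv)
  have "smooth_curve ?B"
    unfolding horizontal_block_def
    by (intro smooth_diff d smooth_linear[OF bounded_linear_scaleR_right] smooth_matrix_mult
        smooth_tuple_endomorphism A)
  moreover have "spans_curve ?B (horizontal_curve l)"
    by (simp add: spans_curve_def horizontal_curve_eq[OF A])
  ultimately show "\<exists>B :: real \<Rightarrow> real^'n^('k \<times> 'n). smooth_curve B \<and> spans_curve B (horizontal_curve l)"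
    by blast
qed

lemma mem_vertical_space_iff:
  fixes A :: "real \<Rightarrow> real^'n^('k::finite \<times> 'n::finite)"
  assumes "CARD('k) \<ge> 2"
  shows "x \<in> vertical_space A t \<longleftrightarrow> (\<exists>c. x = (\<Sum>i<CARD('k) - 1. vderiv i A t *v c i))"
proof -
  let ?S = "{x. \<exists>c. x = (\<Sum>i<CARD('k) - 1. vderiv i A t *v c i)}"
  have I: "{0..CARD('k) - 2} = {..<CARD('k) - 1}" using assms by auto
  have cols: "columns M = (*v) M ` range (\<lambda>i. axis i 1)" for M :: "real^'n^('k \<times> 'n)"
    by (simp add: columns_image_basis)
  have "subspace ?S"
    unfolding subspace_def
  proof (intro conjI ballI allI)
    show "0 \<in> ?S" by (auto intro!: exI[of _ "\<lambda>_. 0"])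
  next
    fix x y assume "x \<in> ?S" "y \<in> ?S"
    then obtain c d where "x = (\<Sum>i<CARD('k) - 1. vderiv i A t *v c i)"
      "y = (\<Sum>i<CARD('k) - 1. vderiv i A t *v d i)" by blast
    then have "x + y = (\<Sum>i<CARD('k) - 1. vderiv i A t *v (c i + d i))"
      by (simp add: mat_vec.add_right sum.distrib)
    then show "x + y \<in> ?S" by (intro CollectI exI)
  next
    fix x and r :: real assume "x \<in> ?S"
    then obtain c where "x = (\<Sum>i<CARD('k) - 1. vderiv i A t *v c i)" by blast
    then have "r *\<^sub>R x = (\<Sum>i<CARD('k) - 1. vderiv i A t *v (r *\<^sub>R c i))"
      by (simp add: mat_vec.scaleR_right scaleR_sum_right)
    then show "r *\<^sub>R x \<in> ?S" by (intro CollectI exI)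
  qed
  moreover have "(\<Union>i\<in>{..<CARD('k) - 1}. columns (vderiv i A t)) \<subseteq> ?S"
  proof
    fix x assume "x \<in> (\<Union>i\<in>{..<CARD('k) - 1}. columns (vderiv i A t))"
    then obtain i j where i: "i < CARD('k) - 1" "x = vderiv i A t *v axis j 1"
      by (auto simp: cols)
    then have "x = (\<Sum>m<CARD('k) - 1. vderiv m A t *v (if m = i then axis j 1 else 0))"
      by (simp add: if_distrib[of "\<lambda>x. _ *v x"] cong: if_cong)
    then show "x \<in> ?S" by (intro CollectI exI)
  qed
  ultimately have "vertical_space A t \<subseteq> ?S"
    unfolding vertical_space_def I by (intro span_minimal)
  moreover have "?S \<subseteq> vertical_space A t"
  proof
    fix x assume "x \<in> ?S"
    then obtain c where x: "x = (\<Sum>i<CARD('k) - 1. vderiv i A t *v c i)" by blast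
    have "vderiv i A t *v y \<in> vertical_space A t" if "i < CARD('k) - 1" for i y
    proof -
      have "vderiv i A t *v y \<in> span (columns (vderiv i A t))"
        by (rule matrix_vector_mult_in_columnspace)
      moreover have "span (columns (vderiv i A t)) \<subseteq> vertical_space A t"
        unfolding vertical_space_def I using that by (intro span_mono) auto
      ultimately show ?thesis by blast
    qed
    then show "x \<in> vertical_space A t"
      unfolding x vertical_space_def by (intro span_sum) auto
  qed
  ultimately show ?thesis by blast
qed

text \<open>
  The horizontal block is $A^{(k-1)}$ modulo the vertical space, so it completes
  $A, \dots, A^{(k-2)}$ to a block basis.
\<close>

lemma transversality_horizontal:
  assumes k: "CARD('k::finite) \<ge> 2"
  shows "transversality (horizontal_curve :: ('k, 'n::finite) assignment)"
  unfolding transversality_def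
proof (intro allI impI)
  fix t and l :: "real \<Rightarrow> (real^('k \<times> 'n)) set" and A :: "real \<Rightarrow> real^'n^('k \<times> 'n)"
  assume "fanning_frame A \<and> spans_curve A l"
  then have A: "fanning_frame A" "spans_curve A l" by auto
  note fan = fanning_frameD(2)[OF A(1), of t]
  let ?B = "horizontal_block (derivatives A t)"
  have expand: "\<exists>d. ?B *v y = (\<Sum>i<CARD('k) - 1. vderiv i A t *v d i) + vderiv (CARD('k) - 1) A t *v y" for y
    by (rule horizontal_block_expand[OF fan]) blast
  have "x = 0" if x: "x \<in> vertical_space A t" "x \<in> range ((*v) ?B)" for x
  proof -
    obtain c where c: "x = (\<Sum>i<CARD('k) - 1. vderiv i A t *v c i)"
      using x(1) mem_vertical_space_iff[OF k] by blast
    obtain y where y: "x = ?B *v y" using x(2) by blast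
    obtain d where d: "?B *v y = (\<Sum>i<CARD('k) - 1. vderiv i A t *v d i) + vderiv (CARD('k) - 1) A t *v y"
      using expand by blast
    have "0 = y"
      by (rule fanning_unique_last[OF fan, of c 0 d y]) (use c y d in simp)
    with y show "x = 0" by simp
  qed
  moreover have "0 \<in> vertical_space A t" by (simp add: vertical_space_def span_zero)
  moreover have "0 \<in> range ((*v) ?B)" by (rule range_eqI[of _ _ 0]) simp
  ultimately have "vertical_space A t \<inter> range ((*v) ?B) = {0}" by blast
  moreover have "\<exists>v w. x = v + w \<and> v \<in> vertical_space A t \<and> w \<in> range ((*v) ?B)" for x
  proof -
    obtain c where c: "x = (\<Sum>i<CARD('k). vderiv i A t *v c i)" by (rule fanning_expand[OF fan])
    let ?w = "?B *v c (CARD('k) - 1)"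
    obtain d where d: "?w = (\<Sum>i<CARD('k) - 1. vderiv i A t *v d i)
        + vderiv (CARD('k) - 1) A t *v c (CARD('k) - 1)"
      using expand by blast
    have "x - ?w = (\<Sum>i<CARD('k) - 1. vderiv i A t *v (c i - d i))"
      unfolding d c sum_split_last_block by (simp add: mat_vec.diff_right sum_subtractf)
    then have "x - ?w \<in> vertical_space A t"
      unfolding mem_vertical_space_iff[OF k] by (intro exI)
    then show ?thesis by (intro exI[of _ "x - ?w"] exI[of _ ?w]) simp
  qed
  ultimately show "complementary (vertical_space A t) (horizontal_curve l t)"
    unfolding complementary_def horizontal_curve_eq[OF A] colspan_eq_range by blast
qed

lemma colspan_horizontal_block_jet_rel:
  assumes "(As, Bs) \<in> jet_rel"
  shows "colspan (horizontal_block Bs) = colspan (horizontal_block As)"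
proof -
  obtain X where X: "As \<in> fanning_tuples" "invertible (X 0)"
    "\<And>m. m \<le> CARD('b) \<Longrightarrow> Bs m = jet_mult As X m"
    using assms by (auto simp: jet_rel_iff)
  then have "horizontal_block Bs = horizontal_block As ** X 0"
    using horizontal_block_cong[of Bs "jet_mult As X"] horizontal_block_jet_mult[of As X] by simp
  then show ?thesis by (simp add: colspan_mult_right X(2))
qed

text \<open>
  The map $j$ takes the horizontal block of any representative of the jet; another
  representative multiplies this block on the right by an invertible matrix.
\<close>

lemma k_jet_dependence_horizontal:
  "k_jet_dependence (horizontal_curve :: ('k::finite, 'n::finite) assignment)"
proof -
  define j :: "(nat \<Rightarrow> real^'n^('k \<times> 'n)) set \<Rightarrow> (real^('k \<times> 'n)) set"
    where "j c = colspan (horizontal_block (SOME As. As \<in> c))" for c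
  have j: "j (jet_rel `` {As}) = colspan (horizontal_block As)" if "As \<in> fanning_tuples" for As
  proof -
    have "(As, As) \<in> jet_rel"
      using that equiv_jet_rel by (meson equivE refl_onD)
    then have "(As, SOME Bs. Bs \<in> jet_rel `` {As}) \<in> jet_rel"
      using someI[of "\<lambda>Bs. Bs \<in> jet_rel `` {As}" As] by simp
    then show ?thesis
      unfolding j_def by (rule colspan_horizontal_block_jet_rel)
  qed
  show ?thesis
    unfolding k_jet_dependence_def
  proof (intro exI[of _ j] conjI allI impI)
    show "j \<in> jet_space \<rightarrow> grassmannian"
      by (auto simp: jet_space_def quotient_def j intro!: colspan_in_grassmannian horizontal_block_inj)
    fix \<tau> and l :: "real \<Rightarrow> (real^('k \<times> 'n)) set" and A :: "real \<Rightarrow> real^'n^('k \<times> 'n)"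
    assume "fanning_frame A \<and> spans_curve A l"
    then show "horizontal_curve l \<tau> = j (jet_class A \<tau>)"
      by (simp add: jet_class_def j fanning_frameD(2) horizontal_curve_eq)
  qed
qed

lemma vderiv_left_mult:
  "smooth_curve A \<Longrightarrow> vderiv i (\<lambda>t. T ** A t) t = (T :: real^'b^'a) ** vderiv i A t"
  using vderiv_linear[OF mat_mult.bounded_linear_right[of T], of A i] by simp

lemma
  fixes A :: "real \<Rightarrow> real^'n^('k::finite \<times> 'n::finite)" and T :: "real^('k \<times> 'n)^('k \<times> 'n)"
  assumes A: "fanning_frame A" and T: "invertible T"
  shows fanning_frame_left_mult: "fanning_frame (\<lambda>t. T ** A t)"
    and spans_curve_left_mult: "spans_curve A l \<Longrightarrow> spans_curve (\<lambda>t. T ** A t) (\<lambda>t. (*v) T ` l t)"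
proof -
  show "fanning_frame (\<lambda>t. T ** A t)"
  proof (rule fanning_frameI)
    show "smooth_curve (\<lambda>t. T ** A t)"
      using smooth_linear[OF mat_mult.bounded_linear_right fanning_frameD(1)[OF A]] .
    show "derivatives (\<lambda>t. T ** A t) t \<in> fanning_tuples" for t
      using fanning_left_mult[OF fanning_frameD(2)[OF A] T]
      by (simp add: vderiv_left_mult[OF fanning_frameD(1)[OF A]])
  qed
  show "spans_curve A l \<Longrightarrow> spans_curve (\<lambda>t. T ** A t) (\<lambda>t. (*v) T ` l t)"
    by (simp add: spans_curve_def colspan_mult_left)
qed

lemma GL_equivariance_horizontal:
  "GL_equivariance (horizontal_curve :: ('k::finite, 'n::finite) assignment)"
  unfolding GL_equivariance_def
proof (intro allI impI)
  fix l :: "real \<Rightarrow> (real^('k \<times> 'n)) set" and T :: "real^('k \<times> 'n)^('k \<times> 'n)"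
  assume l: "fanning_curve l \<and> invertible T"
  then obtain A :: "real \<Rightarrow> real^'n^('k \<times> 'n)" where A: "fanning_frame A" "spans_curve A l"
    by (auto simp: fanning_curve_def)
  have T: "invertible T" using l by simp
  note TA = fanning_frame_left_mult[OF A(1) T] spans_curve_left_mult[OF A(1) T A(2)]
  show "horizontal_curve (\<lambda>t. (*v) T ` l t) = (\<lambda>t. (*v) T ` horizontal_curve l t)"
    by (rule ext) (simp add: horizontal_curve_eq[OF TA] horizontal_curve_eq[OF A]
        vderiv_left_mult[OF fanning_frameD(1)[OF A(1)]]
        horizontal_block_left_mult[OF fanning_frameD(2)[OF A(1)] T] colspan_mult_left)
qed

text \<open>
  The $m$-th derivative of the polynomial of degree below $K$ whose derivatives at the origin
  are $A_0, \dots, A_{K-1}$. Indexing by $m$ lets the whole sequence of derivatives be guessed.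
\<close>

definition taylor :: "nat \<Rightarrow> (nat \<Rightarrow> 'a::real_normed_vector) \<Rightarrow> nat \<Rightarrow> real \<Rightarrow> 'a" where
  "taylor K As m t = (\<Sum>i\<in>{m..<K}. (t ^ (i - m) / fact (i - m)) *\<^sub>R As i)"

lemma taylor_has_vector_derivative:
  "(taylor K As m has_vector_derivative taylor K As (Suc m) t) (at t)"
proof (cases "m < K")
  case True
  then have ivl: "{m..<K} = insert m {Suc m..<K}" by auto
  have "((\<lambda>t. (t ^ (i - m) / fact (i - m)) *\<^sub>R As i) has_vector_derivative
     (t ^ (i - Suc m) / fact (i - Suc m)) *\<^sub>R As i) (at t)" if "i \<in> {Suc m..<K}" for i
  proof -
    define p where "p = i - Suc m"
    have p: "i - m = Suc p" "i - Suc m = p"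
      using that by (auto simp: p_def)
    have "((\<lambda>t. t ^ Suc p / fact (Suc p)) has_real_derivative (t ^ p / fact p)) (at t)"
      using DERIV_cdivide[OF DERIV_pow[of "Suc p" t UNIV], of "fact (Suc p)"]
      by (simp del: power_Suc of_nat_Suc add: fact_Suc)
    then have "((\<lambda>t. t ^ Suc p / fact (Suc p)) has_vector_derivative (t ^ p / fact p)) (at t)"
      by (simp add: has_real_derivative_iff_has_vector_derivative)
    from bounded_linear.has_vector_derivative[OF bounded_linear_scaleR_left this, of "As i"]
    show ?thesis by (simp add: p)
  qed
  then have "((\<lambda>t. \<Sum>i\<in>{Suc m..<K}. (t ^ (i - m) / fact (i - m)) *\<^sub>R As i) has_vector_derivative
      taylor K As (Suc m) t) (at t)"
    unfolding taylor_def by (rule has_vector_derivative_sum)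
  then have "((\<lambda>t. As m + (\<Sum>i\<in>{Suc m..<K}. (t ^ (i - m) / fact (i - m)) *\<^sub>R As i)) has_vector_derivative
      0 + taylor K As (Suc m) t) (at t)"
    by (intro has_vector_derivative_add has_vector_derivative_const)
  moreover have "taylor K As m = (\<lambda>t. As m + (\<Sum>i\<in>{Suc m..<K}. (t ^ (i - m) / fact (i - m)) *\<^sub>R As i))"
    unfolding taylor_def ivl by simp
  ultimately show ?thesis by simp
next
  case False
  then show ?thesis by (simp add: taylor_def[abs_def])
qed

lemma smooth_taylor: "smooth_curve (taylor K As 0)"
  by (rule smooth_tower[where g = "taylor K As"]) (rule taylor_has_vector_derivative)

lemma vderiv_taylor: "vderiv m (taylor K As 0) = taylor K As m"
  by (rule vderiv_tower[where g = "taylor K As"]) (rule taylor_has_vector_derivative)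

lemma taylor_at_0: "taylor K As m 0 = (if m < K then As m else 0)"
proof -
  have "taylor K As m 0 = (\<Sum>i\<in>{m..<K}. if i = m then As m else 0)"
    unfolding taylor_def by (rule sum.cong) (auto simp: power_0_left)
  then show ?thesis by simp
qed

lemma taylor_eq_0: "K \<le> m \<Longrightarrow> taylor K As m t = 0"
  by (simp add: taylor_def)

lemma taylor_last: "0 < K \<Longrightarrow> taylor K As (K - 1) t = As (K - 1)"
  by (cases K) (simp_all add: taylor_def)

lemma polynomial_eq_taylor:
  fixes As :: "nat \<Rightarrow> 'a::real_normed_vector"
  assumes "0 < K"
  shows "(\<Sum>i=0..K - 1. t ^ i *\<^sub>R As i) = taylor K (\<lambda>i. fact i *\<^sub>R As i) 0 t"
proof -
  have "{0..K - 1} = {0..<K}" using assms by auto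
  then show ?thesis by (simp add: taylor_def)
qed

text \<open>
  The $i$-th derivative at $t$ is $A_i$ plus a combination of later coefficients. Downward
  induction on $i$ recovers every $A_i$ from the derivatives.
\<close>

lemma fanning_taylor:
  fixes As :: "nat \<Rightarrow> real^'n^('k::finite \<times> 'n::finite)"
  assumes As: "As \<in> fanning_tuples"
  shows "(\<lambda>m. taylor CARD('k) As m t) \<in> fanning_tuples"
proof (rule fanning_if_spanning[OF As])
  let ?R = "range ((*v) (block_matrix (\<lambda>m. taylor CARD('k) As m t)))"
  fix i y assume "i < CARD('k)"
  then show "As i *v y \<in> ?R"
  proof (induction "CARD('k) - i" arbitrary: i rule: less_induct)
    case less
    have "{i..<CARD('k)} = insert i {Suc i..<CARD('k)}" using less.prems by auto
    then have "taylor CARD('k) As i t *v y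
       = As i *v y + (\<Sum>m\<in>{Suc i..<CARD('k)}. (t ^ (m - i) / fact (m - i)) *\<^sub>R (As m *v y))"
      by (simp add: taylor_def mat_vec.add_left mat_vec.sum_left mat_vec.scaleR_left)
    then have "As i *v y = taylor CARD('k) As i t *v y
        - (\<Sum>m\<in>{Suc i..<CARD('k)}. (t ^ (m - i) / fact (m - i)) *\<^sub>R (As m *v y))"
      by simp
    also have "\<dots> \<in> ?R"
      using less block_column_in_range[of i "\<lambda>m. taylor CARD('k) As m t" y]
      by (intro subspace_diff subspace_sum subspace_scale subspace_matrix_range) auto
    finally show ?case .
  qed
qed

lemma fanning_frame_taylor:
  fixes As :: "nat \<Rightarrow> real^'n^('k::finite \<times> 'n::finite)"
  assumes "As \<in> fanning_tuples"
  shows "fanning_frame (taylor CARD('k) As 0)"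
  using assms by (intro fanning_frameI smooth_taylor) (simp add: vderiv_taylor fanning_taylor)

text \<open>
  The $k$-th derivative of a polynomial of degree below $k$ vanishes, so the horizontal
  block is just its $(k-1)$-st derivative, which is constant. A polynomial that spans a fanning
  curve is automatically a fanning frame.
\<close>

lemma constant_on_polynomials_horizontal:
  "constant_on_polynomials (horizontal_curve :: ('k::finite, 'n::finite) assignment)"
  unfolding constant_on_polynomials_def
proof (intro allI impI)
  fix l :: "real \<Rightarrow> (real^('k \<times> 'n)) set" and As :: "nat \<Rightarrow> real^'n^('k \<times> 'n)"
  define Bs where "Bs i = (fact i :: real) *\<^sub>R As i" for i
  assume "fanning_curve l \<and> spans_curve (\<lambda>t. \<Sum>i=0..CARD('k) - 1. t ^ i *\<^sub>R As i) l"
  then have l: "fanning_curve l" "spans_curve (taylor CARD('k) Bs 0) l"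
    by (simp_all add: polynomial_eq_taylor Bs_def[abs_def] del: One_nat_def)
  then obtain A :: "real \<Rightarrow> real^'n^('k \<times> 'n)" where A: "fanning_frame A" "spans_curve A l"
    by (auto simp: fanning_curve_def)
  have B: "fanning_frame (taylor CARD('k) Bs 0)"
    by (rule fanning_frame_if_spans[OF A(1) smooth_taylor A(2) l(2)])
  have "horizontal_curve l t = colspan (Bs (CARD('k) - 1))" for t
    unfolding horizontal_curve_eq[OF B l(2)]
    by (simp add: horizontal_block_def vderiv_taylor taylor_eq_0 taylor_last[simplified])
  then show "\<exists>V. \<forall>t. horizontal_curve l t = V" by blast
qed

section \<open>Uniqueness\<close>

text \<open>
  The witness is twice the identity minus the orthogonal projection onto the line.
\<close>

lemma exists_matrix_fixing_line:
  fixes e :: "real^'n"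
  assumes "e \<noteq> 0"
  obtains g :: "real^'n^'n" where "invertible g" "g *v e = e" "\<And>y. g *v y = y \<Longrightarrow> \<exists>r. y = r *\<^sub>R e"
proof
  define f where "f y = 2 *\<^sub>R y - ((e \<bullet> y) / (e \<bullet> e)) *\<^sub>R e" for y
  have "linear f"
    unfolding f_def
    by (intro linearI) (simp_all add: inner_add_right add_divide_distrib algebra_simps)
  then have f: "matrix f *v y = f y" for y
    using matrix_works[of f] linear_matrix_vector_mul_eq by simp
  show "matrix f *v e = e"
    using assms by (simp add: f f_def scaleR_2)
  show "\<exists>r. y = r *\<^sub>R e" if "matrix f *v y = y" for y
  proof -
    have "y = ((e \<bullet> y) / (e \<bullet> e)) *\<^sub>R e"
      using that by (simp add: f f_def scaleR_2 algebra_simps)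
    then show ?thesis by blast
  qed
  have "y = 0" if "matrix f *v y = 0" for y
  proof -
    have eq: "2 *\<^sub>R y = ((e \<bullet> y) / (e \<bullet> e)) *\<^sub>R e"
      using that by (simp add: f f_def)
    then have "e \<bullet> (2 *\<^sub>R y) = e \<bullet> (((e \<bullet> y) / (e \<bullet> e)) *\<^sub>R e)" by simp
    then have "e \<bullet> y = 0" using assms by simp
    with eq show "y = 0" by simp
  qed
  then show "invertible (matrix f)"
    by (simp add: invertible_left_inverse matrix_left_invertible_ker)
qed

lemma block_map_expand:
  fixes As :: "nat \<Rightarrow> real^'n^('k::finite \<times> 'n::finite)"
  assumes "As \<in> fanning_tuples"
  shows "block_map As Bs *v (\<Sum>i<CARD('k). As i *v c i) = (\<Sum>i<CARD('k). Bs i *v c i)"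
  using block_map_mult[OF assms, of _ Bs]
  by (simp add: mat_vec.sum_right matrix_vector_mul_assoc)

text \<open>
  The linear algebra behind uniqueness. Let $V$ meet the span of the first $k - 1$ blocks
  trivially, so that a vector $x = \sum_i B_i c_i$ of $V$ is determined by its last
  coefficient $e = c_{k-1}$.

  Invariance under the block diagonal action of $GL(n)$, applied to a matrix whose fixed space is
  the line of $e$, shows that $x$ itself is fixed, whence $c_i = \lambda_i e$ for all $i$.
  The shift, which is the map moving the jet of the polynomial curve at $0$ to its jet at $1$,
  then multiplies $x$ by a scalar $\mu$. If $\lambda_q$ were the first nonzero coefficient and
  $q < k - 1$, the coefficients at $q$ would give $\mu = 1$, and those at $q + 1$ would give
  $\lambda_{q+1} + \lambda_q = \lambda_{q+1}$. So only the last coefficient survives.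
\<close>

lemma invariant_complement_subset_last_block:
  fixes Bs :: "nat \<Rightarrow> real^'n^('k::finite \<times> 'n::finite)"
  assumes Bs: "Bs \<in> fanning_tuples" and V: "subspace V"
    and V_inter: "\<And>c. (\<Sum>i<CARD('k) - 1. Bs i *v c i) \<in> V \<Longrightarrow> (\<Sum>i<CARD('k) - 1. Bs i *v c i) = 0"
    and g_inv: "\<And>(g :: real^'n^'n) c. invertible g \<Longrightarrow> (\<Sum>i<CARD('k). Bs i *v c i) \<in> V \<Longrightarrow>
      (\<Sum>i<CARD('k). Bs i *v (g *v c i)) \<in> V"
    and shift_inv: "\<And>c. (\<Sum>i<CARD('k). Bs i *v c i) \<in> V \<Longrightarrow>
      (\<Sum>m<CARD('k). Bs m *v (\<Sum>i\<le>m. (1 / fact (m - i)) *\<^sub>R c i)) \<in> V"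
  shows "V \<subseteq> colspan (Bs (CARD('k) - 1))"
proof -
  (* A vector of V without last coefficient is vertical, hence zero. *)
  have small: "c i = 0"
    if cV: "(\<Sum>i<CARD('k). Bs i *v c i) \<in> V" and last: "c (CARD('k) - 1) = 0" and i: "i < CARD('k)" for c i
  proof -
    have "(\<Sum>i<CARD('k). Bs i *v c i) = (\<Sum>i<CARD('k) - 1. Bs i *v c i)"
      unfolding sum_split_last_block last by simp
    with cV have "(\<Sum>i<CARD('k). Bs i *v c i) = (\<Sum>i<CARD('k). Bs i *v 0)"
      using V_inter[of c] by simp
    then show ?thesis using i by (rule fanning_unique[OF Bs])
  qed
  show ?thesis
  proof
    fix x assume x: "x \<in> V"
    obtain c where c: "x = (\<Sum>i<CARD('k). Bs i *v c i)" by (rule fanning_expand[OF Bs])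
    define e where "e = c (CARD('k) - 1)"
    show "x \<in> colspan (Bs (CARD('k) - 1))"
    proof (cases "e = 0")
      case True
      then have "x = 0" using small[of c] x by (simp add: c e_def)
      then show ?thesis by (simp add: colspan_def span_zero)
    next
      case False
      then obtain g where g: "invertible g" "g *v e = e" "\<And>y. g *v y = y \<Longrightarrow> \<exists>r. y = r *\<^sub>R e"
        using exists_matrix_fixing_line by blast
      have "g *v c i - c i = 0" if "i < CARD('k)" for i
      proof (rule small)
        have "(\<Sum>i<CARD('k). Bs i *v (g *v c i)) - x \<in> V"
          using V x g_inv[OF g(1), of c] by (intro subspace_diff) (auto simp: c)
        then show "(\<Sum>i<CARD('k). Bs i *v (g *v c i - c i)) \<in> V"
          by (simp add: c mat_vec.diff_right sum_subtractf)
      qed (use that g(2) in \<open>simp_all add: e_def\<close>)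
      then have "\<exists>r. c i = r *\<^sub>R e" if "i < CARD('k)" for i
        using g(3)[of "c i"] that by simp
      then obtain lam where lam: "\<And>i. i < CARD('k) \<Longrightarrow> c i = lam i *\<^sub>R e" by metis
      define nu where "nu m = (\<Sum>i\<le>m. lam i / fact (m - i))" for m
      have "(lam (CARD('k) - 1) - 1) *\<^sub>R e = 0"
        unfolding scaleR_diff_left e_def using lam[of "CARD('k) - 1"] by (simp add: e_def)
      then have last: "lam (CARD('k) - 1) = 1" using False by simp
      define \<mu> where "\<mu> = nu (CARD('k) - 1)"
      have nu: "nu m = \<mu> * lam m" if m: "m < CARD('k)" for m
      proof -
        have sh: "(\<Sum>i\<le>m. (1 / fact (m - i)) *\<^sub>R c i) = nu m *\<^sub>R e" if "m < CARD('k)" for m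
          using that lam by (simp add: nu_def scaleR_sum_left)
        have "nu m *\<^sub>R e - \<mu> *\<^sub>R c m = 0"
        proof (rule small)
          have "(\<Sum>m<CARD('k). Bs m *v (nu m *\<^sub>R e)) \<in> V"
            using shift_inv[of c] x sh by (simp add: c)
          then have "(\<Sum>m<CARD('k). Bs m *v (nu m *\<^sub>R e)) - \<mu> *\<^sub>R x \<in> V"
            using V x by (intro subspace_diff subspace_scale)
          then show "(\<Sum>m<CARD('k). Bs m *v (nu m *\<^sub>R e - \<mu> *\<^sub>R c m)) \<in> V"
            by (simp add: c mat_vec.diff_right sum_subtractf mat_vec.scaleR_right scaleR_sum_right)
          show "nu (CARD('k) - 1) *\<^sub>R e - \<mu> *\<^sub>R c (CARD('k) - 1) = 0"
            by (simp add: \<mu>_def e_def)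
        qed (rule m)
        then have "(nu m - \<mu> * lam m) *\<^sub>R e = 0"
          by (simp add: lam[OF m] scaleR_diff_left)
        then show ?thesis using False by simp
      qed
      have "lam i = 0" if i: "i < CARD('k) - 1" for i
      proof (rule ccontr)
        assume "lam i \<noteq> 0"
        (* The shift is unipotent, so the first nonzero coefficient forces mu = 1. *)
        define q where "q = (LEAST i. lam i \<noteq> 0)"
        have q: "lam q \<noteq> 0" "q \<le> i"
          unfolding q_def using LeastI[of "\<lambda>i. lam i \<noteq> 0"] Least_le[of "\<lambda>i. lam i \<noteq> 0"]
            \<open>lam i \<noteq> 0\<close> by blast+
        have below: "lam r = 0" if "r < q" for r
          using that not_less_Least unfolding q_def by blast
        have "nu q = lam q"
        proof -
          have "nu q = (\<Sum>r\<le>q. if r = q then lam q else 0)"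
            unfolding nu_def by (rule sum.cong) (auto simp: below)
          then show ?thesis by simp
        qed
        then have "\<mu> = 1" using nu[of q] q i by simp
        moreover have "nu (Suc q) = lam (Suc q) + lam q"
        proof -
          have "nu (Suc q) = lam (Suc q) + (\<Sum>r\<le>q. lam r / fact (Suc q - r))"
            unfolding nu_def by (simp add: add.commute)
          also have "(\<Sum>r\<le>q. lam r / fact (Suc q - r)) = (\<Sum>r\<le>q. if r = q then lam q else 0)"
            by (rule sum.cong) (auto simp: below)
          finally show ?thesis by simp
        qed
        ultimately have "lam q = 0" using nu[of "Suc q"] q i by simp
        with q show False by simp
      qed
      then have "c i = 0" if "i < CARD('k) - 1" for i
        using lam[of i] that by simp
      then have "x = Bs (CARD('k) - 1) *v e"
        unfolding c sum_split_last_block e_def by simp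
      then show ?thesis by (simp add: colspan_eq_range)
    qed
  qed
qed

text \<open>
  Let $V$ be the constant value of $H$ on the curve of a polynomial frame $B$. Right
  multiplication of the coefficients by $g$ in $GL(n)$ is induced by a linear map of the ambient
  space which preserves the curve, hence preserves $V$. The linear map carrying the jet of $B$ at
  $0$ to its jet at $1$ sends the value of $H$ at $0$ to its value at $1$, since jets do not
  remember the time at which they are taken; both values are $V$. So $V$ satisfies the hypotheses
  of the preceding lemma, and a dimension count turns the inclusion into an equality.
\<close>

lemma horizontal_of_taylor_unique:
  fixes H :: "('k::finite, 'n::finite) assignment" and Bs :: "nat \<Rightarrow> real^'n^('k \<times> 'n)"
  assumes k: "CARD('k) \<ge> 2" and Gr: "grassmannian_assignment H" and H: "four_properties H"
    and Bs: "Bs \<in> fanning_tuples"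
  shows "H (\<lambda>t. colspan (taylor CARD('k) Bs 0 t)) 0 = colspan (Bs (CARD('k) - 1))"
proof -
  define B where "B = taylor CARD('k) Bs 0"
  define p where "p = (\<lambda>t. colspan (B t))"
  define V where "V = H p 0"
  have dB: "vderiv m B = taylor CARD('k) Bs m" for m
    by (simp add: B_def vderiv_taylor)
  have fanB: "fanning_frame B" unfolding B_def by (rule fanning_frame_taylor[OF Bs])
  have spanB: "spans_curve B p" by (simp add: spans_curve_def p_def)
  have fanp: "fanning_curve p" using fanB spanB unfolding fanning_curve_def by blast
  obtain j where j: "\<And>l A \<tau>. fanning_frame A \<Longrightarrow> spans_curve A l \<Longrightarrow> H l \<tau> = j (jet_class A \<tau>)"
    using H by (auto simp: four_properties_def k_jet_dependence_def)
  have GL: "H (\<lambda>t. (*v) T ` p t) = (\<lambda>t. (*v) T ` H p t)" if "invertible T" for T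
    using H fanp that by (simp add: four_properties_def GL_equivariance_def)

  have V: "subspace V" "dim V = CARD('n)"
    using Gr fanp by (auto simp: V_def grassmannian_assignment_def smooth_grassmannian_curve_def grassmannian_def)
  have "complementary (vertical_space B 0) V"
    using H fanB spanB by (auto simp: V_def four_properties_def transversality_def)
  then have inter: "x = 0" if "x \<in> V" "x \<in> vertical_space B 0" for x
    using that by (auto simp: complementary_def)
  have V_inter: "(\<Sum>i<CARD('k) - 1. Bs i *v c i) = 0" if "(\<Sum>i<CARD('k) - 1. Bs i *v c i) \<in> V" for c
  proof (rule inter[OF that])
    have "(\<Sum>i<CARD('k) - 1. Bs i *v c i) = (\<Sum>i<CARD('k) - 1. vderiv i B 0 *v c i)"
      by (rule sum.cong) (auto simp: dB taylor_at_0)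
    then show "(\<Sum>i<CARD('k) - 1. Bs i *v c i) \<in> vertical_space B 0"
      unfolding mem_vertical_space_iff[OF k] by (intro exI)
  qed

  have g_inv: "(\<Sum>i<CARD('k). Bs i *v (g *v c i)) \<in> V"
    if g: "invertible g" and c: "(\<Sum>i<CARD('k). Bs i *v c i) \<in> V" for g :: "real^'n^'n" and c
  proof -
    define T where "T = block_map Bs (\<lambda>i. Bs i ** g)"
    have "jet_mult Bs (\<lambda>i. if i = 0 then g else 0) m = (\<Sum>i=0..m. if i = 0 then Bs m ** g else 0)" for m
      unfolding jet_mult_def by (rule sum.cong) auto
    then have "jet_mult Bs (\<lambda>i. if i = 0 then g else 0) = (\<lambda>i. Bs i ** g)" by auto
    then have "(\<lambda>i. Bs i ** g) \<in> fanning_tuples"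
      using fanning_jet_mult[OF Bs, of "\<lambda>i. if i = 0 then g else 0"] g by simp
    then have T: "invertible T"
      unfolding T_def by (rule invertible_block_map[OF Bs])
    have "T ** B t = B t ** g" for t
      using block_map_mult[OF Bs, of _ "\<lambda>i. Bs i ** g"]
      by (simp add: B_def taylor_def T_def mat_mult.sum_right mat_mult.sum_left
          mat_mult.scaleR_left mat_mult.scaleR_right)
    then have "(*v) T ` p t = p t" for t
      unfolding p_def colspan_mult_left[symmetric] by (simp add: colspan_mult_right g)
    then have "(\<lambda>t. (*v) T ` p t) = p" by (rule ext)
    from GL[OF T, unfolded this] have "V = (*v) T ` V" unfolding V_def by (rule fun_cong)
    moreover have "T *v (\<Sum>i<CARD('k). Bs i *v c i) = (\<Sum>i<CARD('k). Bs i *v (g *v c i))"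
      unfolding T_def block_map_expand[OF Bs] by (simp add: matrix_vector_mul_assoc)
    ultimately show ?thesis using c by (metis imageI)
  qed

  have shift_inv: "(\<Sum>m<CARD('k). Bs m *v (\<Sum>i\<le>m. (1 / fact (m - i)) *\<^sub>R c i)) \<in> V"
    if c: "(\<Sum>i<CARD('k). Bs i *v c i) \<in> V" for c
  proof -
    define T where "T = block_map Bs (\<lambda>i. taylor CARD('k) Bs i 1)"
    have T: "invertible T"
      unfolding T_def by (intro invertible_block_map[OF Bs] fanning_taylor[OF Bs])
    (* Beyond order k - 1 both sides vanish, so the full jets agree. *)
    have dTB: "derivatives (\<lambda>t. T ** B t) 0 = derivatives B 1"
    proof
      fix i
      have "vderiv i (\<lambda>t. T ** B t) 0 = T ** vderiv i B 0"
        by (rule vderiv_left_mult[OF fanning_frameD(1)[OF fanB]])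
      also have "\<dots> = vderiv i B 1"
        using block_map_mult[OF Bs, of i "\<lambda>i. taylor CARD('k) Bs i 1"]
        by (cases "i < CARD('k)") (simp_all add: dB taylor_at_0 T_def taylor_eq_0)
      finally show "vderiv i (\<lambda>t. T ** B t) 0 = vderiv i B 1" .
    qed
    have "(*v) T ` V = H (\<lambda>t. (*v) T ` p t) 0"
      using GL[OF T] by (simp add: V_def)
    also have "\<dots> = j (jet_class (\<lambda>t. T ** B t) 0)"
      by (intro j fanning_frame_left_mult spans_curve_left_mult fanB spanB T)
    also have "\<dots> = H p 1"
      using j[OF fanB spanB] by (simp add: jet_class_def dTB)
    also have "H p 1 = V"
    proof -
      have "(\<Sum>i=0..CARD('k) - 1. t ^ i *\<^sub>R ((1 / fact i) *\<^sub>R Bs i)) = B t" for t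
        unfolding polynomial_eq_taylor[OF zero_less_card_finite] B_def by simp
      then have poly: "spans_curve (\<lambda>t. \<Sum>i=0..CARD('k) - 1. t ^ i *\<^sub>R ((1 / fact i) *\<^sub>R Bs i)) p"
        by (simp only: spans_curve_def p_def) simp
      have "constant_on_polynomials H"
        using H by (simp add: four_properties_def)
      then have "\<exists>W. \<forall>t. H p t = W"
        by (rule constant_on_polynomials_def[THEN iffD1, rule_format, OF _ conjI, OF _ fanp poly])
      then obtain W where "\<And>t. H p t = W" by blast
      then show ?thesis by (simp add: V_def)
    qed
    finally have "(*v) T ` V = V" .
    then have "T *v (\<Sum>i<CARD('k). Bs i *v c i) \<in> V" using c by blast
    also have "T *v (\<Sum>i<CARD('k). Bs i *v c i)
        = (\<Sum>i<CARD('k). \<Sum>m\<in>{i..<CARD('k)}. Bs m *v ((1 / fact (m - i)) *\<^sub>R c i))"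
      unfolding T_def block_map_expand[OF Bs]
      by (simp add: taylor_def mat_vec.sum_left mat_vec.scaleR_left mat_vec.scaleR_right)
    also have "\<dots> = (\<Sum>m<CARD('k). \<Sum>i\<le>m. Bs m *v ((1 / fact (m - i)) *\<^sub>R c i))"
      by (simp add: sum.Sigma, rule sum.reindex_bij_witness[where
            i = "\<lambda>(m, i). (i, m)" and j = "\<lambda>(i, m). (m, i)"]) auto
    finally show ?thesis by (simp add: mat_vec.sum_right)
  qed

  have "V \<subseteq> colspan (Bs (CARD('k) - 1))"
    using Bs V(1) V_inter g_inv shift_inv by (rule invariant_complement_subset_last_block)
  moreover have "dim (colspan (Bs (CARD('k) - 1))) \<le> dim V"
    using dim_image_le[of "(*v) (Bs (CARD('k) - 1))" UNIV] V(2) by (simp add: colspan_eq_range)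
  ultimately have "V = colspan (Bs (CARD('k) - 1))"
    using V(1) by (intro subspace_dim_equal) (auto simp: colspan_def)
  then show ?thesis by (simp add: V_def p_def B_def)
qed

text \<open>
  Every $k$-jet is represented by a frame with $A^{(k)} = 0$. Writing
  $A_k = \sum_{i<k} A_i Q_i$, the choice $X_0 = I$ and
  $X_i = - \binom{k}{i}^{-1} Q_{k-i}$ makes the $k$-th Leibniz sum vanish. The remaining
  coefficients are those of a polynomial curve with the given jet at the origin.
\<close>

lemma jet_of_polynomial:
  fixes As :: "nat \<Rightarrow> real^'n^('k::finite \<times> 'n::finite)"
  assumes As: "As \<in> fanning_tuples"
  obtains Bs where "Bs \<in> fanning_tuples"
    "(As, derivatives (taylor CARD('k) Bs 0) 0) \<in> jet_rel"
proof -
  obtain Q where Q: "As CARD('k) = (\<Sum>i<CARD('k). As i ** Q i)"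
    by (rule fanning_expand_matrix[OF As])
  define X where "X i = (if i = 0 then mat 1
     else - (1 / real (CARD('k) choose i)) *\<^sub>R Q (CARD('k) - i))" for i
  define Bs where "Bs = jet_mult As X"
  have X0: "invertible (X 0)"
    unfolding X_def invertible_def by (auto intro: exI[of _ "mat 1"])
  have "Bs CARD('k) = 0"
  proof -
    have "{0..CARD('k)} = insert 0 {1..CARD('k)}" by auto
    then have "Bs CARD('k) = As CARD('k)
       + (\<Sum>i\<in>{1..CARD('k)}. real (CARD('k) choose i) *\<^sub>R (As (CARD('k) - i) ** X i))"
      by (simp add: Bs_def jet_mult_def X_def)
    also have "(\<Sum>i\<in>{1..CARD('k)}. real (CARD('k) choose i) *\<^sub>R (As (CARD('k) - i) ** X i))
       = (\<Sum>i\<in>{1..CARD('k)}. - (As (CARD('k) - i) ** Q (CARD('k) - i)))"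
      by (rule sum.cong) (auto simp: X_def mat_mult.scaleR_right mat_mult.minus_right)
    also have "\<dots> = (\<Sum>i<CARD('k). - (As i ** Q i))"
      by (rule sum.reindex_bij_witness[where i = "\<lambda>i. CARD('k) - i" and j = "\<lambda>i. CARD('k) - i"]) auto
    finally show ?thesis by (simp add: Q sum_negf)
  qed
  then have "derivatives (taylor CARD('k) Bs 0) 0 m = jet_mult As X m" if "m \<le> CARD('k)" for m
    using that by (cases "m = CARD('k)") (simp_all add: vderiv_taylor taylor_at_0 Bs_def)
  then have "(As, derivatives (taylor CARD('k) Bs 0) 0) \<in> jet_rel"
    by (intro jet_relI[of As X, OF As X0])
  moreover have "Bs \<in> fanning_tuples"
    unfolding Bs_def by (rule fanning_jet_mult[of As X, OF As X0])
  ultimately show ?thesis by (intro that)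
qed

theorem theorem4p5:
  assumes "CARD('k::finite) \<ge> 2"
  shows "grassmannian_assignment (horizontal_curve :: ('k, 'n::finite) assignment)
       \<and> four_properties (horizontal_curve :: ('k, 'n) assignment)
       \<and> (\<forall>H :: ('k, 'n) assignment.
            grassmannian_assignment H \<and> four_properties H \<longrightarrow>
            (\<forall>l. fanning_curve l \<longrightarrow> H l = horizontal_curve l))"
proof (intro conjI allI impI)
  show Gr: "grassmannian_assignment (horizontal_curve :: ('k, 'n) assignment)"
    by (rule grassmannian_assignment_horizontal)
  show four: "four_properties (horizontal_curve :: ('k, 'n) assignment)"
    unfolding four_properties_def
    by (intro conjI transversality_horizontal assms k_jet_dependence_horizontal
        GL_equivariance_horizontal constant_on_polynomials_horizontal)
  fix H :: "('k, 'n) assignment" and l :: "real \<Rightarrow> (real^('k \<times> 'n)) set"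
  assume H: "grassmannian_assignment H \<and> four_properties H" and "fanning_curve l"
  then obtain A :: "real \<Rightarrow> real^'n^('k \<times> 'n)" where A: "fanning_frame A" "spans_curve A l"
    by (auto simp: fanning_curve_def)
  show "H l = horizontal_curve l"
  proof
    fix \<tau>
    obtain Bs :: "nat \<Rightarrow> real^'n^('k \<times> 'n)" where Bs: "Bs \<in> fanning_tuples"
      "(derivatives A \<tau>, derivatives (taylor CARD('k) Bs 0) 0) \<in> jet_rel"
      by (rule jet_of_polynomial[OF fanning_frameD(2)[OF A(1)]])
    define B where "B = taylor CARD('k) Bs 0"
    have B: "fanning_frame B" "spans_curve B (\<lambda>t. colspan (B t))"
      unfolding B_def by (simp_all add: fanning_frame_taylor Bs(1) spans_curve_def)
    have jets: "jet_class A \<tau> = jet_class B 0"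
      unfolding jet_class_def B_def by (rule jet_class_eq[OF Bs(2)])
    have "G l \<tau> = colspan (Bs (CARD('k) - 1))"
      if G: "grassmannian_assignment G" "four_properties G" for G :: "('k, 'n) assignment"
    proof -
      obtain j where j: "\<And>l A \<tau>. fanning_frame A \<Longrightarrow> spans_curve A l \<Longrightarrow> G l \<tau> = j (jet_class A \<tau>)"
        using G(2) by (auto simp: four_properties_def k_jet_dependence_def)
      have "G l \<tau> = G (\<lambda>t. colspan (B t)) 0"
        unfolding j[OF A] j[OF B] jets ..
      also have "\<dots> = colspan (Bs (CARD('k) - 1))"
        unfolding B_def by (rule horizontal_of_taylor_unique[OF assms G Bs(1)])
      finally show ?thesis .
    qed
    then show "H l \<tau> = horizontal_curve l \<tau>"
      using H Gr four by metis
  qed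
qed

end
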